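(* Let $A$ be a reduced Noetherian ring whose singular locus has the (finite) stratification $\operatorname{Strata}(A)=\{V_1,\dots,V_s\}$, with $s\ge 1$. For $i=1,\dots,s$, let an intermediate ring $A\subseteq A^{(i)}\subseteq\overline{A}$ be given such that $S^{-1}A^{(i)}=\overline{S^{-1}A}$ for each $S=A\setminus P$ with $P\in V_i$. Then $$\sum_{i=1}^{s}A^{(i)}=\overline{A}.$$
   Context: Rings are commutative with $1$. For a reduced Noetherian ring $A$, $\operatorname{Q}(A)$ denotes its total ring of fractions, and the normalization $\overline{A}$ is the integral closure of $A$ in $\operatorname{Q}(A)$. The singular locus is $\operatorname{Sing}(A)=\{P\in\operatorname{Spec}(A)\mid A_P \text{ is not regular}\}$. Stratification: for $P\in\operatorname{Sing}(A)$, set $$L_P=\bigcap_{\widetilde P\in\operatorname{Sing}(A),\ \widetilde P\subseteq P}\widetilde P .$$ Let $\mathcal{L}=\{L_P\mid P\in\operatorname{Sing}(A)\}$. The strata are the sets $V_L=\{P\in\operatorname{Sing}(A)\mid L_P=L\}$, $L\in\mathcal{L}$, and $\operatorname{Strata}(A)=\{V_L\mid L\in\mathcal{L}\}$ is the set of all strata. For $S=A\setminus P$ with $P$ a prime ideal of $A$, and an $A$-module $M$, $S^{-1}M$ denotes the localization of $M$ at $S$; $\overline{S^{-1}A}$ is the normalization of the ring $S^{-1}A=A_P$. Since $A$ is reduced Noetherian, $S^{-1}\operatorname{Q}(A)$ is identified with $\operatorname{Q}(S^{-1}A)$, and the equality $S^{-1}A^{(i)}=\overline{S^{-1}A}$ is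 an equality of subrings of this ring. The sum $\sum_i A^{(i)}$ is the sum of $A$-submodules of $\operatorname{Q}(A)$. *)

theory Defs
  imports "HOL-Algebra.Algebra" "HOL-Library.Extended_Nat"
begin

section \<open>Localization of a commutative ring\<close>

definition loc_rel :: "('a, 'm) ring_scheme \<Rightarrow> 'a set \<Rightarrow> (('a \<times> 'a) \<times> ('a \<times> 'a)) set" where
  "loc_rel R S = {((a, s), (b, t)). a \<in> carrier R \<and> s \<in> S \<and> b \<in> carrier R \<and> t \<in> S \<and>
     (\<exists>u\<in>S. u \<otimes>\<^bsub>R\<^esub> (t \<otimes>\<^bsub>R\<^esub> a) = u \<otimes>\<^bsub>R\<^esub> (s \<otimes>\<^bsub>R\<^esub> b))}"

definition mk_frac :: "('a, 'm) ring_scheme \<Rightarrow> 'a set \<Rightarrow> 'a \<Rightarrow> 'a \<Rightarrow> ('a \<times> 'a) set" where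
  "mk_frac R S a s = loc_rel R S `` {(a, s)}"

text \<open>The operations are defined on equivalence classes; since they respect \<open>loc_rel\<close>, each union
  below is a union of equal classes (see \<open>frac_mult\<close> and \<open>frac_add\<close>).\<close>

definition localization :: "('a, 'm) ring_scheme \<Rightarrow> 'a set \<Rightarrow> ('a \<times> 'a) set ring" where
  "localization R S =
    \<lparr>carrier = (carrier R \<times> S) // loc_rel R S,
     monoid.mult = (\<lambda>x y. \<Union>(a, s)\<in>x. \<Union>(b, t)\<in>y. mk_frac R S (a \<otimes>\<^bsub>R\<^esub> b) (s \<otimes>\<^bsub>R\<^esub> t)),
     monoid.one = mk_frac R S \<one>\<^bsub>R\<^esub> \<one>\<^bsub>R\<^esub>,
     ring.zero = mk_frac R S \<zero>\<^bsub>R\<^esub> \<one>\<^bsub>R\<^esub>,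
     ring.add = (\<lambda>x y. \<Union>(a, s)\<in>x. \<Union>(b, t)\<in>y.
              mk_frac R S ((t \<otimes>\<^bsub>R\<^esub> a) \<oplus>\<^bsub>R\<^esub> (s \<otimes>\<^bsub>R\<^esub> b)) (s \<otimes>\<^bsub>R\<^esub> t))\<rparr>"

definition loc_map :: "('a, 'm) ring_scheme \<Rightarrow> 'a set \<Rightarrow> 'a \<Rightarrow> ('a \<times> 'a) set" where
  "loc_map R S a = mk_frac R S a \<one>\<^bsub>R\<^esub>"

text \<open>The map \<open>a/s \<mapsto> f a / f s\<close> on the localization of \<open>R\<close> at \<open>S\<close> induced by a ring homomorphism
  \<open>f\<close> from \<open>R\<close> to \<open>T\<close> that sends \<open>S\<close> to units (see \<open>loc_lift_frac\<close>).\<close>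

definition loc_lift ::
    "('b, 'n) ring_scheme \<Rightarrow> ('a \<Rightarrow> 'b) \<Rightarrow> ('a \<times> 'a) set \<Rightarrow> 'b" where
  "loc_lift T f x = the_elem ((\<lambda>(a, s). f a \<otimes>\<^bsub>T\<^esub> inv\<^bsub>T\<^esub> (f s)) ` x)"

definition loc_subset :: "('a, 'm) ring_scheme \<Rightarrow> 'a set \<Rightarrow> 'a set \<Rightarrow> ('a \<times> 'a) set set" where
  "loc_subset R S B = {mk_frac R S b s | b s. b \<in> B \<and> s \<in> S}"


section \<open>Total ring of fractions and normalization\<close>

definition nonzerodivisors :: "('a, 'm) ring_scheme \<Rightarrow> 'a set" where
  "nonzerodivisors R =
    {b \<in> carrier R. \<forall>a\<in>carrier R. b \<otimes>\<^bsub>R\<^esub> a = \<zero>\<^bsub>R\<^esub> \<longrightarrow> a = \<zero>\<^bsub>R\<^esub>}"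

definition total_fractions :: "('a, 'm) ring_scheme \<Rightarrow> ('a \<times> 'a) set ring" where
  "total_fractions R = localization R (nonzerodivisors R)"

definition to_fractions :: "('a, 'm) ring_scheme \<Rightarrow> 'a \<Rightarrow> ('a \<times> 'a) set" where
  "to_fractions R = loc_map R (nonzerodivisors R)"

text \<open>A monic polynomial over \<open>K\<close> is a nonempty coefficient list over \<open>K\<close>, highest coefficient
  first, with head \<open>\<one>\<close>.\<close>

definition integral_over :: "('a, 'm) ring_scheme \<Rightarrow> 'a set \<Rightarrow> 'a \<Rightarrow> bool" where
  "integral_over R K x \<longleftrightarrow>
    (\<exists>p. p \<noteq> [] \<and> set p \<subseteq> K \<and> lead_coeff p = \<one>\<^bsub>R\<^esub> \<and> ring.eval R p x = \<zero>\<^bsub>R\<^esub>)"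

definition integral_closure :: "('a, 'm) ring_scheme \<Rightarrow> 'a set \<Rightarrow> 'a set" where
  "integral_closure R K = {x \<in> carrier R. integral_over R K x}"

definition normalization :: "('a, 'm) ring_scheme \<Rightarrow> ('a \<times> 'a) set set" where
  "normalization R = integral_closure (total_fractions R) (to_fractions R ` carrier R)"

definition reduced_ring :: "('a, 'm) ring_scheme \<Rightarrow> bool" where
  "reduced_ring R \<longleftrightarrow>
    (\<forall>x\<in>carrier R. \<forall>n::nat. x [^]\<^bsub>R\<^esub> n = \<zero>\<^bsub>R\<^esub> \<longrightarrow> x = \<zero>\<^bsub>R\<^esub>)"


section \<open>Singular locus and strata\<close>

definition krull_dim :: "('a, 'm) ring_scheme \<Rightarrow> enat" where
  "krull_dim R = Sup {enat n | n. \<exists>p :: nat \<Rightarrow> 'a set.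
     (\<forall>i\<le>n. primeideal (p i) R) \<and> (\<forall>i<n. p i \<subset> p (Suc i))}"

text \<open>A regular local ring is a Noetherian local ring whose maximal ideal can be generated by
  \<open>krull_dim R\<close> elements. By Krull's height theorem no smaller number of generators is possible,
  so asking for a generating set of exactly this cardinality is no restriction.\<close>

definition regular_local_ring :: "('a, 'm) ring_scheme \<Rightarrow> bool" where
  "regular_local_ring R \<longleftrightarrow> cring R \<and> noetherian_ring R \<and>
    (\<exists>M. {I. maximalideal I R} = {M} \<and>
      (\<exists>G\<subseteq>carrier R. finite G \<and> M = genideal R G \<and> enat (card G) = krull_dim R))"

definition Sing :: "('a, 'm) ring_scheme \<Rightarrow> 'a set set" where
  "Sing A = {P. primeideal P A \<and> \<not> regular_local_ring (localization A (carrier A - P))}"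

definition stratum_ideal :: "('a, 'm) ring_scheme \<Rightarrow> 'a set \<Rightarrow> 'a set" where
  "stratum_ideal A P = \<Inter>{P' \<in> Sing A. P' \<subseteq> P}"

definition stratum :: "('a, 'm) ring_scheme \<Rightarrow> 'a set \<Rightarrow> 'a set set" where
  "stratum A L = {P \<in> Sing A. stratum_ideal A P = L}"

definition Strata :: "('a, 'm) ring_scheme \<Rightarrow> 'a set set set" where
  "Strata A = stratum A ` (stratum_ideal A ` Sing A)"


section \<open>Localizing subrings of the total ring of fractions\<close>

text \<open>For a multiplicative set \<open>S\<close> of \<open>A\<close>, the localization of the \<open>A\<close>-module \<open>total_fractions A\<close>
  at \<open>S\<close> is its localization, as a ring, at the image of \<open>S\<close>. The localization of an intermediate
  ring \<open>B\<close> is the subring of all \<open>b/s\<close> in it.\<close>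

definition loc_total :: "('a, 'm) ring_scheme \<Rightarrow> 'a set \<Rightarrow> (('a \<times> 'a) set \<times> ('a \<times> 'a) set) set ring"
  where "loc_total A S = localization (total_fractions A) (to_fractions A ` S)"

definition loc_intermediate ::
    "('a, 'm) ring_scheme \<Rightarrow> 'a set \<Rightarrow> ('a \<times> 'a) set set \<Rightarrow> (('a \<times> 'a) set \<times> ('a \<times> 'a) set) set set"
  where "loc_intermediate A S B = loc_subset (total_fractions A) (to_fractions A ` S) B"

text \<open>The canonical \<open>A\<close>-algebra map from \<open>loc_total A S\<close> to the total ring of fractions of the
  localization of \<open>A\<close> at \<open>S\<close>, sending \<open>(a/b)/s\<close> to \<open>(a/1)/(bs/1)\<close> (see \<open>loc_total_map_frac\<close>). It is obtained by extending the
  composite \<open>a \<mapsto> (a/1)/(1/1)\<close> first to \<open>total_fractions A\<close> and then to \<open>loc_total A S\<close>; for reduced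
  Noetherian \<open>A\<close> and \<open>S\<close> the complement of a prime it is the identification of the two rings.\<close>

definition fractions_map ::
    "('a, 'm) ring_scheme \<Rightarrow> 'a set \<Rightarrow> ('a \<times> 'a) set \<Rightarrow> (('a \<times> 'a) set \<times> ('a \<times> 'a) set) set" where
  "fractions_map A S = loc_lift (total_fractions (localization A S))
     (\<lambda>a. to_fractions (localization A S) (loc_map A S a))"

definition loc_total_map ::
    "('a, 'm) ring_scheme \<Rightarrow> 'a set \<Rightarrow>
     (('a \<times> 'a) set \<times> ('a \<times> 'a) set) set \<Rightarrow> (('a \<times> 'a) set \<times> ('a \<times> 'a) set) set" where
  "loc_total_map A S = loc_lift (total_fractions (localization A S)) (fractions_map A S)"


section \<open>Well-definedness of the constructions\<close>

locale mult_set = cring R + submonoid S R for R (structure) and S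
begin

lemma S_carr [simp]: "s \<in> S \<Longrightarrow> s \<in> carrier R"
  using subset by blast

lemma equiv_loc_rel: "equiv (carrier R \<times> S) (loc_rel R S)"
proof (rule equivI)
  show "loc_rel R S \<subseteq> (carrier R \<times> S) \<times> carrier R \<times> S" by (auto simp: loc_rel_def)
  show "refl_on (carrier R \<times> S) (loc_rel R S)"
    using one_closed by (auto simp: refl_on_def loc_rel_def)
  show "sym (loc_rel R S)" by (rule symI) (auto simp: loc_rel_def, metis)
  show "trans (loc_rel R S)"
  proof (rule transI, clarify)
    fix a s b t c v assume 1: "((a, s), b, t) \<in> loc_rel R S" and 2: "((b, t), c, v) \<in> loc_rel R S"
    from 1 obtain u where u: "u \<in> S" "u \<otimes> (t \<otimes> a) = u \<otimes> (s \<otimes> b)" by (auto simp: loc_rel_def)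
    from 2 obtain w where w: "w \<in> S" "w \<otimes> (v \<otimes> b) = w \<otimes> (t \<otimes> c)" by (auto simp: loc_rel_def)
    from 1 2 have c: "a \<in> carrier R" "b \<in> carrier R" "c \<in> carrier R" "s \<in> S" "t \<in> S" "v \<in> S"
      by (auto simp: loc_rel_def)
    have "(u \<otimes> w \<otimes> t) \<otimes> (v \<otimes> a) = (w \<otimes> v) \<otimes> (u \<otimes> (t \<otimes> a))"
      using c u(1) w(1) by (simp add: m_ac)
    also have "\<dots> = (u \<otimes> s) \<otimes> (w \<otimes> (v \<otimes> b))"
      unfolding u(2) using c u(1) w(1) by (simp add: m_ac)
    also have "\<dots> = (u \<otimes> w \<otimes> t) \<otimes> (s \<otimes> c)"
      unfolding w(2) using c u(1) w(1) by (simp add: m_ac)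
    finally show "((a, s), c, v) \<in> loc_rel R S"
      using c u w unfolding loc_rel_def by blast
  qed
qed

lemma frac_eq_iff:
  assumes "a \<in> carrier R" "s \<in> S" "b \<in> carrier R" "t \<in> S"
  shows "mk_frac R S a s = mk_frac R S b t \<longleftrightarrow> (\<exists>u\<in>S. u \<otimes> (t \<otimes> a) = u \<otimes> (s \<otimes> b))"
proof -
  have "mk_frac R S a s = mk_frac R S b t \<longleftrightarrow> ((a, s), (b, t)) \<in> loc_rel R S"
    unfolding mk_frac_def using assms by (intro eq_equiv_class_iff[OF equiv_loc_rel]) auto
  thus ?thesis using assms by (auto simp: loc_rel_def)
qed

lemma frac_eqI:
  assumes "a \<in> carrier R" "s \<in> S" "b \<in> carrier R" "t \<in> S" "t \<otimes> a = s \<otimes> b"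
  shows "mk_frac R S a s = mk_frac R S b t"
  using assms frac_eq_iff by fastforce

lemma carrier_localization:
  "carrier (localization R S) = {mk_frac R S a s | a s. a \<in> carrier R \<and> s \<in> S}"
  by (auto simp: localization_def quotient_def mk_frac_def)

lemma frac_closed [simp]:
  "a \<in> carrier R \<Longrightarrow> s \<in> S \<Longrightarrow> mk_frac R S a s \<in> carrier (localization R S)"
  by (auto simp: carrier_localization)

lemma frac_mult:
  assumes "a \<in> carrier R" "s \<in> S" "b \<in> carrier R" "t \<in> S"
  shows "mk_frac R S a s \<otimes>\<^bsub>localization R S\<^esub> mk_frac R S b t = mk_frac R S (a \<otimes> b) (s \<otimes> t)"
proof -
  have "(\<lambda>x y. case x of (a, s) \<Rightarrow> case y of (b, t) \<Rightarrow> mk_frac R S (a \<otimes> b) (s \<otimes> t)) respects2 loc_rel R S"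
  proof (rule congruent2_commuteI[OF equiv_loc_rel]; clarify)
    fix a s b t c v assume 1: "((a, s), b, t) \<in> loc_rel R S" and 2: "c \<in> carrier R" "v \<in> S"
    from 1 obtain u where u: "u \<in> S" "u \<otimes> (t \<otimes> a) = u \<otimes> (s \<otimes> b)" by (auto simp: loc_rel_def)
    from 1 have c: "a \<in> carrier R" "b \<in> carrier R" "s \<in> S" "t \<in> S" by (auto simp: loc_rel_def)
    have "u \<otimes> ((v \<otimes> t) \<otimes> (c \<otimes> a)) = (v \<otimes> c) \<otimes> (u \<otimes> (t \<otimes> a))"
      using c u(1) 2 by (simp add: m_ac)
    also have "\<dots> = u \<otimes> ((v \<otimes> s) \<otimes> (c \<otimes> b))"
      unfolding u(2) using c u(1) 2 by (simp add: m_ac)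
    finally show "mk_frac R S (c \<otimes> a) (v \<otimes> s) = mk_frac R S (c \<otimes> b) (v \<otimes> t)"
      using u(1) c 2 by (subst frac_eq_iff) auto
  qed (simp add: m_ac)
  from UN_equiv_class2[OF equiv_loc_rel equiv_loc_rel this, of "(a, s)" "(b, t)"] assms
  show ?thesis by (simp add: localization_def mk_frac_def[symmetric] split_def)
qed

lemma frac_add:
  assumes "a \<in> carrier R" "s \<in> S" "b \<in> carrier R" "t \<in> S"
  shows "mk_frac R S a s \<oplus>\<^bsub>localization R S\<^esub> mk_frac R S b t
    = mk_frac R S ((t \<otimes> a) \<oplus> (s \<otimes> b)) (s \<otimes> t)"
proof -
  have "(\<lambda>x y. case x of (a, s) \<Rightarrow> case y of (b, t) \<Rightarrow>
      mk_frac R S ((t \<otimes> a) \<oplus> (s \<otimes> b)) (s \<otimes> t)) respects2 loc_rel R S"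
  proof (rule congruent2_commuteI[OF equiv_loc_rel]; clarify)
    fix a s b t assume "a \<in> carrier R" "s \<in> S" "b \<in> carrier R" "t \<in> S"
    thus "mk_frac R S (t \<otimes> a \<oplus> s \<otimes> b) (s \<otimes> t) = mk_frac R S (s \<otimes> b \<oplus> t \<otimes> a) (t \<otimes> s)"
      by (simp add: m_ac a_comm)
  next
    fix a s b t c v assume 1: "((a, s), b, t) \<in> loc_rel R S" and 2: "c \<in> carrier R" "v \<in> S"
    from 1 obtain u where u: "u \<in> S" "u \<otimes> (t \<otimes> a) = u \<otimes> (s \<otimes> b)" by (auto simp: loc_rel_def)
    from 1 have c: "a \<in> carrier R" "b \<in> carrier R" "s \<in> S" "t \<in> S" by (auto simp: loc_rel_def)
    have "u \<otimes> ((v \<otimes> t) \<otimes> (s \<otimes> c \<oplus> v \<otimes> a))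
        = u \<otimes> (v \<otimes> t \<otimes> (s \<otimes> c)) \<oplus> (v \<otimes> v) \<otimes> (u \<otimes> (t \<otimes> a))"
      using c u(1) 2 by (simp add: r_distr m_ac)
    also have "\<dots> = u \<otimes> ((v \<otimes> s) \<otimes> (t \<otimes> c \<oplus> v \<otimes> b))"
      unfolding u(2) using c u(1) 2 by (simp add: r_distr m_ac)
    finally show "mk_frac R S (s \<otimes> c \<oplus> v \<otimes> a) (v \<otimes> s) = mk_frac R S (t \<otimes> c \<oplus> v \<otimes> b) (v \<otimes> t)"
      using u(1) c 2 by (subst frac_eq_iff) auto
  qed
  from UN_equiv_class2[OF equiv_loc_rel equiv_loc_rel this, of "(a, s)" "(b, t)"] assms
  show ?thesis by (simp add: localization_def mk_frac_def[symmetric] split_def)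
qed

lemma one_localization: "\<one>\<^bsub>localization R S\<^esub> = mk_frac R S \<one> \<one>"
  and zero_localization: "\<zero>\<^bsub>localization R S\<^esub> = mk_frac R S \<zero> \<one>"
  by (auto simp: localization_def)

lemma localization_cases:
  assumes "x \<in> carrier (localization R S)"
  obtains a s where "x = mk_frac R S a s" "a \<in> carrier R" "s \<in> S"
  using assms by (auto simp: carrier_localization)

lemma cring_localization: "cring (localization R S)"
proof (rule cringI)
  let ?L = "localization R S"
  show "abelian_group ?L"
  proof (rule abelian_groupI)
    fix x y assume x: "x \<in> carrier ?L" and y: "y \<in> carrier ?L"
    from x obtain a s where a: "x = mk_frac R S a s" "a \<in> carrier R" "s \<in> S"
      by (rule localization_cases)
    from y obtain b t where b: "y = mk_frac R S b t" "b \<in> carrier R" "t \<in> S"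
      by (rule localization_cases)
    show "x \<oplus>\<^bsub>?L\<^esub> y \<in> carrier ?L"
      using a b by (simp add: frac_add)
    show "x \<oplus>\<^bsub>?L\<^esub> y = y \<oplus>\<^bsub>?L\<^esub> x"
      using a b by (simp add: frac_add m_comm a_comm)
    fix z assume "z \<in> carrier ?L"
    then obtain c v where c: "z = mk_frac R S c v" "c \<in> carrier R" "v \<in> S"
      by (rule localization_cases)
    show "x \<oplus>\<^bsub>?L\<^esub> y \<oplus>\<^bsub>?L\<^esub> z = x \<oplus>\<^bsub>?L\<^esub> (y \<oplus>\<^bsub>?L\<^esub> z)"
      using a b c by (simp add: frac_add r_distr m_ac a_ac)
  next
    show "\<zero>\<^bsub>?L\<^esub> \<in> carrier ?L" by (simp add: zero_localization)
  next
    fix x assume "x \<in> carrier ?L"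
    then obtain a s where x: "x = mk_frac R S a s" "a \<in> carrier R" "s \<in> S"
      by (rule localization_cases)
    then show "\<zero>\<^bsub>?L\<^esub> \<oplus>\<^bsub>?L\<^esub> x = x" by (simp add: zero_localization frac_add)
    have "s \<otimes> \<ominus> a \<oplus> s \<otimes> a = \<zero>" using x by (simp add: r_minus l_neg)
    then have "mk_frac R S (\<ominus> a) s \<oplus>\<^bsub>?L\<^esub> x = mk_frac R S \<zero> (s \<otimes> s)"
      using x by (simp add: frac_add)
    also have "\<dots> = \<zero>\<^bsub>?L\<^esub>"
      unfolding zero_localization using x by (intro frac_eqI) auto
    finally show "\<exists>y\<in>carrier ?L. y \<oplus>\<^bsub>?L\<^esub> x = \<zero>\<^bsub>?L\<^esub>" using x by (metis a_inv_closed frac_closed)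
  qed
  show "comm_monoid ?L"
    by (rule comm_monoidI)
      (auto elim!: localization_cases simp: frac_mult one_localization m_ac)
  fix x y z assume xyz: "x \<in> carrier ?L" "y \<in> carrier ?L" "z \<in> carrier ?L"
  from xyz(1) obtain a s where a: "x = mk_frac R S a s" "a \<in> carrier R" "s \<in> S"
    by (rule localization_cases)
  from xyz(2) obtain b t where b: "y = mk_frac R S b t" "b \<in> carrier R" "t \<in> S"
    by (rule localization_cases)
  from xyz(3) obtain c v where c: "z = mk_frac R S c v" "c \<in> carrier R" "v \<in> S"
    by (rule localization_cases)
  show "(x \<oplus>\<^bsub>?L\<^esub> y) \<otimes>\<^bsub>?L\<^esub> z = x \<otimes>\<^bsub>?L\<^esub> z \<oplus>\<^bsub>?L\<^esub> y \<otimes>\<^bsub>?L\<^esub> z"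
    unfolding a(1) b(1) c(1) using a b c
    by (simp add: frac_add frac_mult) (rule frac_eqI, auto simp: r_distr l_distr m_ac)
qed

lemma loc_map_hom: "loc_map R S \<in> ring_hom R (localization R S)"
  by (rule ring_hom_memI) (auto simp: loc_map_def frac_mult frac_add one_localization)

lemma loc_map_Units:
  assumes "s \<in> S"
  shows "loc_map R S s \<in> Units (localization R S)"
    and "inv\<^bsub>localization R S\<^esub> (loc_map R S s) = mk_frac R S \<one> s"
proof -
  interpret L: cring "localization R S" by (rule cring_localization)
  have 1: "loc_map R S s \<otimes>\<^bsub>localization R S\<^esub> mk_frac R S \<one> s = \<one>\<^bsub>localization R S\<^esub>"
    using assms by (simp add: loc_map_def frac_mult one_localization frac_eqI)
  have c: "loc_map R S s \<in> carrier (localization R S)"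
    "mk_frac R S \<one> s \<in> carrier (localization R S)"
    using assms by (auto simp: loc_map_def)
  show "loc_map R S s \<in> Units (localization R S)"
    by (rule L.unit_factor[OF _ c]) (simp add: 1)
  show "inv\<^bsub>localization R S\<^esub> (loc_map R S s) = mk_frac R S \<one> s"
    by (rule L.comm_inv_char[OF c 1])
qed

lemma loc_lift_frac:
  assumes T: "cring T" and f: "f \<in> ring_hom R T" and U: "f ` S \<subseteq> Units T"
    and as: "a \<in> carrier R" "s \<in> S"
  shows "loc_lift T f (mk_frac R S a s) = f a \<otimes>\<^bsub>T\<^esub> inv\<^bsub>T\<^esub> (f s)"
proof -
  interpret T: cring T by (rule T)
  note hom = ring_hom_mult[OF f]
  have fc: "\<And>x. x \<in> carrier R \<Longrightarrow> f x \<in> carrier T" by (rule ring_hom_closed[OF f])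
  have fU: "\<And>x. x \<in> S \<Longrightarrow> f x \<in> Units T" using U by blast
  have eq: "f b \<otimes>\<^bsub>T\<^esub> inv\<^bsub>T\<^esub> (f t) = f a \<otimes>\<^bsub>T\<^esub> inv\<^bsub>T\<^esub> (f s)"
    if "((a, s), (b, t)) \<in> loc_rel R S" for b t
  proof -
    from that obtain u where u: "u \<in> S" "u \<otimes> (t \<otimes> a) = u \<otimes> (s \<otimes> b)"
      and bt: "b \<in> carrier R" "t \<in> S" by (auto simp: loc_rel_def)
    have "f u \<otimes>\<^bsub>T\<^esub> (f t \<otimes>\<^bsub>T\<^esub> f a) = f u \<otimes>\<^bsub>T\<^esub> (f s \<otimes>\<^bsub>T\<^esub> f b)"
      using arg_cong[OF u(2), of f] u(1) bt as by (simp add: hom)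
    then have e: "f t \<otimes>\<^bsub>T\<^esub> f a = f s \<otimes>\<^bsub>T\<^esub> f b"
      using u(1) bt as fU fc by (subst (asm) T.Units_l_cancel) auto
    have i: "inv\<^bsub>T\<^esub> (f t) \<in> carrier T" "inv\<^bsub>T\<^esub> (f s) \<in> carrier T" "f a \<in> carrier T" "f b \<in> carrier T"
        "f s \<in> carrier T" "f t \<in> carrier T"
      using fU fc bt as by auto
    have "f b \<otimes>\<^bsub>T\<^esub> inv\<^bsub>T\<^esub> (f t) = (inv\<^bsub>T\<^esub> (f s) \<otimes>\<^bsub>T\<^esub> f s) \<otimes>\<^bsub>T\<^esub> (f b \<otimes>\<^bsub>T\<^esub> inv\<^bsub>T\<^esub> (f t))"
      using i as fU by simp
    also have "\<dots> = inv\<^bsub>T\<^esub> (f s) \<otimes>\<^bsub>T\<^esub> inv\<^bsub>T\<^esub> (f t) \<otimes>\<^bsub>T\<^esub> (f s \<otimes>\<^bsub>T\<^esub> f b)"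
      using i by (simp add: T.m_ac)
    also have "\<dots> = (inv\<^bsub>T\<^esub> (f t) \<otimes>\<^bsub>T\<^esub> f t) \<otimes>\<^bsub>T\<^esub> (f a \<otimes>\<^bsub>T\<^esub> inv\<^bsub>T\<^esub> (f s))"
      unfolding e[symmetric] using i by (simp add: T.m_ac)
    also have "\<dots> = f a \<otimes>\<^bsub>T\<^esub> inv\<^bsub>T\<^esub> (f s)"
      using i bt fU by simp
    finally show ?thesis .
  qed
  have img: "g ` M = {c}" if "y \<in> M" and "\<And>x. x \<in> M \<Longrightarrow> g x = c" for g M y c
    using that by force
  have "(a, s) \<in> mk_frac R S a s"
    using equiv_loc_rel as by (auto simp: mk_frac_def equiv_def refl_on_def)
  moreover have "(case x of (b, t) \<Rightarrow> f b \<otimes>\<^bsub>T\<^esub> inv\<^bsub>T\<^esub> (f t)) = f a \<otimes>\<^bsub>T\<^esub> inv\<^bsub>T\<^esub> (f s)"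
    if "x \<in> mk_frac R S a s" for x
    using that eq by (cases x) (simp add: mk_frac_def)
  ultimately have "(\<lambda>(b, t). f b \<otimes>\<^bsub>T\<^esub> inv\<^bsub>T\<^esub> (f t)) ` mk_frac R S a s
      = {f a \<otimes>\<^bsub>T\<^esub> inv\<^bsub>T\<^esub> (f s)}"
    by (rule img)
  then show ?thesis by (simp add: loc_lift_def)
qed

lemma loc_lift_hom:
  assumes T: "cring T" and f: "f \<in> ring_hom R T" and U: "f ` S \<subseteq> Units T"
  shows "loc_lift T f \<in> ring_hom (localization R S) T"
proof -
  interpret T: cring T by (rule T)
  note lift = loc_lift_frac[OF T f U]
  have fc: "f x \<in> carrier T" if "x \<in> carrier R" for x by (rule ring_hom_closed[OF f that])
  have fU: "f x \<in> Units T" if "x \<in> S" for x using U that by blast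
  have i: "inv\<^bsub>T\<^esub> f x \<in> carrier T" if "x \<in> S" for x using fU[OF that] by simp
  have inv2: "inv\<^bsub>T\<^esub> (f s \<otimes>\<^bsub>T\<^esub> f t) = inv\<^bsub>T\<^esub> f s \<otimes>\<^bsub>T\<^esub> inv\<^bsub>T\<^esub> f t" if "s \<in> S" "t \<in> S" for s t
  proof (rule T.comm_inv_char)
    have "f s \<otimes>\<^bsub>T\<^esub> f t \<otimes>\<^bsub>T\<^esub> (inv\<^bsub>T\<^esub> f s \<otimes>\<^bsub>T\<^esub> inv\<^bsub>T\<^esub> f t)
        = (f s \<otimes>\<^bsub>T\<^esub> inv\<^bsub>T\<^esub> f s) \<otimes>\<^bsub>T\<^esub> (f t \<otimes>\<^bsub>T\<^esub> inv\<^bsub>T\<^esub> f t)"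
      using that by (simp add: fc i T.m_ac)
    then show "f s \<otimes>\<^bsub>T\<^esub> f t \<otimes>\<^bsub>T\<^esub> (inv\<^bsub>T\<^esub> f s \<otimes>\<^bsub>T\<^esub> inv\<^bsub>T\<^esub> f t) = \<one>\<^bsub>T\<^esub>" using that fU by simp
  qed (use that fc i in auto)
  show ?thesis
  proof (rule ring_hom_memI)
    fix x assume "x \<in> carrier (localization R S)"
    then obtain a s where x: "x = mk_frac R S a s" "a \<in> carrier R" "s \<in> S"
      by (rule localization_cases)
    then show "loc_lift T f x \<in> carrier T" by (simp add: lift fc i)
  next
    fix x y assume xy: "x \<in> carrier (localization R S)" "y \<in> carrier (localization R S)"
    from xy(1) obtain a s where a: "x = mk_frac R S a s" "a \<in> carrier R" "s \<in> S"
      by (rule localization_cases)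
    from xy(2) obtain b t where b: "y = mk_frac R S b t" "b \<in> carrier R" "t \<in> S"
      by (rule localization_cases)
    show "loc_lift T f (x \<otimes>\<^bsub>localization R S\<^esub> y) = loc_lift T f x \<otimes>\<^bsub>T\<^esub> loc_lift T f y"
      using a b by (simp add: frac_mult lift inv2 ring_hom_mult[OF f] fc i T.m_ac)
    have "loc_lift T f (x \<oplus>\<^bsub>localization R S\<^esub> y)
        = (f t \<otimes>\<^bsub>T\<^esub> f a \<oplus>\<^bsub>T\<^esub> f s \<otimes>\<^bsub>T\<^esub> f b) \<otimes>\<^bsub>T\<^esub> (inv\<^bsub>T\<^esub> f s \<otimes>\<^bsub>T\<^esub> inv\<^bsub>T\<^esub> f t)"
      using a b by (simp add: frac_add lift inv2 ring_hom_mult[OF f] ring_hom_add[OF f])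
    also have "\<dots> = f a \<otimes>\<^bsub>T\<^esub> inv\<^bsub>T\<^esub> f s \<otimes>\<^bsub>T\<^esub> (f t \<otimes>\<^bsub>T\<^esub> inv\<^bsub>T\<^esub> f t)
        \<oplus>\<^bsub>T\<^esub> f b \<otimes>\<^bsub>T\<^esub> inv\<^bsub>T\<^esub> f t \<otimes>\<^bsub>T\<^esub> (f s \<otimes>\<^bsub>T\<^esub> inv\<^bsub>T\<^esub> f s)"
      using a b by (simp add: fc i T.l_distr T.r_distr T.m_ac)
    also have "\<dots> = loc_lift T f x \<oplus>\<^bsub>T\<^esub> loc_lift T f y"
      using a b by (simp add: lift fU fc i)
    finally show "loc_lift T f (x \<oplus>\<^bsub>localization R S\<^esub> y) = loc_lift T f x \<oplus>\<^bsub>T\<^esub> loc_lift T f y" .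
  next
    have "inv\<^bsub>T\<^esub> (f \<one>) = \<one>\<^bsub>T\<^esub>" by (simp add: ring_hom_one[OF f])
    then show "loc_lift T f \<one>\<^bsub>localization R S\<^esub> = \<one>\<^bsub>T\<^esub>"
      by (simp add: one_localization lift ring_hom_one[OF f])
  qed
qed

lemma loc_map_nonzerodivisor:
  assumes "b \<in> nonzerodivisors R"
  shows "loc_map R S b \<in> nonzerodivisors (localization R S)"
proof -
  have b: "b \<in> carrier R" and nzd: "\<And>a. a \<in> carrier R \<Longrightarrow> b \<otimes> a = \<zero> \<Longrightarrow> a = \<zero>"
    using assms by (auto simp: nonzerodivisors_def)
  have "x = \<zero>\<^bsub>localization R S\<^esub>"
    if x: "x \<in> carrier (localization R S)"
      "loc_map R S b \<otimes>\<^bsub>localization R S\<^esub> x = \<zero>\<^bsub>localization R S\<^esub>" for x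
  proof -
    from x(1) obtain a s where a: "x = mk_frac R S a s" "a \<in> carrier R" "s \<in> S"
      by (rule localization_cases)
    then have "mk_frac R S (b \<otimes> a) s = mk_frac R S \<zero> \<one>"
      using x(2) b by (simp add: loc_map_def frac_mult zero_localization)
    then obtain u where u: "u \<in> S" "u \<otimes> (b \<otimes> a) = \<zero>"
      using a b by (auto simp: frac_eq_iff)
    have "b \<otimes> (u \<otimes> a) = \<zero>" using a b u(1) u(2) by (metis S_carr m_lcomm)
    then have "u \<otimes> a = \<zero>" using nzd a u(1) by simp
    then show ?thesis
      using a u(1) by (auto simp: zero_localization frac_eq_iff)
  qed
  then show ?thesis using b by (auto simp: nonzerodivisors_def loc_map_def)
qed

end

lemma mult_set_nonzerodivisors:
  fixes R (structure)
  assumes "cring R" shows "mult_set R (nonzerodivisors R)"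
proof -
  interpret cring R by fact
  show ?thesis
  proof (intro mult_set.intro assms submonoid.intro)
    fix x y assume x: "x \<in> nonzerodivisors R" and y: "y \<in> nonzerodivisors R"
    have c: "x \<in> carrier R" "y \<in> carrier R" using x y by (simp_all add: nonzerodivisors_def)
    have "a = \<zero>" if a: "a \<in> carrier R" "x \<otimes> y \<otimes> a = \<zero>" for a
    proof -
      have "x \<otimes> (y \<otimes> a) = \<zero>" using a c by (simp add: m_assoc)
      then have "y \<otimes> a = \<zero>" using x a c by (simp add: nonzerodivisors_def)
      then show ?thesis using y a by (simp add: nonzerodivisors_def)
    qed
    then show "x \<otimes> y \<in> nonzerodivisors R" using c by (simp add: nonzerodivisors_def)
  qed (auto simp: nonzerodivisors_def)
qed

lemma mult_set_prime_complement:
  fixes R (structure)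
  assumes "primeideal P R" shows "mult_set R (carrier R - P)"
proof -
  interpret primeideal P R by fact
  show ?thesis
    using I_prime one_imp_carrier I_notcarr
    by (intro mult_set.intro submonoid.intro is_cring) auto
qed

lemma (in mult_set) mult_set_loc_total:
  "mult_set (total_fractions R) (to_fractions R ` S)"
proof -
  interpret N: mult_set R "nonzerodivisors R" by (rule mult_set_nonzerodivisors) (rule is_cring)
  show ?thesis
    unfolding total_fractions_def to_fractions_def
  proof (intro mult_set.intro submonoid.intro N.cring_localization)
    show "loc_map R (nonzerodivisors R) ` S \<subseteq> carrier (localization R (nonzerodivisors R))"
      by (auto intro: ring_hom_closed[OF N.loc_map_hom])
    show "\<one>\<^bsub>localization R (nonzerodivisors R)\<^esub> \<in> loc_map R (nonzerodivisors R) ` S"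
      by (metis N.loc_map_hom imageI one_closed ring_hom_one)
    show "x \<otimes>\<^bsub>localization R (nonzerodivisors R)\<^esub> y \<in> loc_map R (nonzerodivisors R) ` S"
      if "x \<in> loc_map R (nonzerodivisors R) ` S" "y \<in> loc_map R (nonzerodivisors R) ` S" for x y
      using that by (auto simp flip: ring_hom_mult[OF N.loc_map_hom])
  qed
qed

lemma (in mult_set) loc_total_map_frac:
  assumes "a \<in> carrier R" and b: "b \<in> nonzerodivisors R" and s: "s \<in> S"
  shows "loc_total_map R S (mk_frac (total_fractions R) (to_fractions R ` S)
           (mk_frac R (nonzerodivisors R) a b) (to_fractions R s))
    = mk_frac (localization R S) (nonzerodivisors (localization R S))
        (loc_map R S a) (loc_map R S (b \<otimes> s))"
proof -
  let ?L = "localization R S" and ?N = "nonzerodivisors R"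
  let ?Q = "total_fractions ?L" and ?f = "\<lambda>a. to_fractions ?L (loc_map R S a)"
  interpret L: cring ?L by (rule cring_localization)
  interpret N: mult_set R ?N by (rule mult_set_nonzerodivisors) (rule is_cring)
  interpret NL: mult_set ?L "nonzerodivisors ?L" by (rule mult_set_nonzerodivisors) (rule L.is_cring)
  interpret T: mult_set "total_fractions R" "to_fractions R ` S" by (rule mult_set_loc_total)
  interpret Q: cring ?Q unfolding total_fractions_def by (rule NL.cring_localization)
  have nL: "loc_map R S x \<in> nonzerodivisors ?L" if "x \<in> ?N \<or> x \<in> S" for x
    using that
  proof
    assume "x \<in> S"
    note U = loc_map_Units(1)[OF this]
    have "y = \<zero>\<^bsub>?L\<^esub>" if "y \<in> carrier ?L" "loc_map R S x \<otimes>\<^bsub>?L\<^esub> y = \<zero>\<^bsub>?L\<^esub>" for y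
      using U that L.Units_l_cancel[of "loc_map R S x" y "\<zero>\<^bsub>?L\<^esub>"] L.Units_closed[OF U] by simp
    then show ?thesis using L.Units_closed[OF U] unfolding nonzerodivisors_def by blast
  qed (rule loc_map_nonzerodivisor)
  have f: "?f \<in> ring_hom R ?Q"
    using ring_hom_trans[OF loc_map_hom NL.loc_map_hom]
    by (simp add: to_fractions_def total_fractions_def comp_def)
  have U: "?f x \<in> Units ?Q" and inv_f: "inv\<^bsub>?Q\<^esub> (?f x)
      = mk_frac ?L (nonzerodivisors ?L) \<one>\<^bsub>?L\<^esub> (loc_map R S x)" if "x \<in> ?N \<or> x \<in> S" for x
    using NL.loc_map_Units[OF nL[OF that]] by (auto simp: to_fractions_def total_fractions_def)
  have UN: "?f ` ?N \<subseteq> Units ?Q" using U by auto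
  have g: "fractions_map R S \<in> ring_hom (total_fractions R) ?Q"
    unfolding fractions_map_def using N.loc_lift_hom[OF Q.is_cring f UN]
    by (simp add: total_fractions_def)
  have g_frac: "fractions_map R S (mk_frac R ?N a b) = ?f a \<otimes>\<^bsub>?Q\<^esub> inv\<^bsub>?Q\<^esub> (?f b)"
    if "a \<in> carrier R" "b \<in> ?N" for a b
    unfolding fractions_map_def using N.loc_lift_frac[OF Q.is_cring f UN that] .
  have fc: "?f x \<in> carrier ?Q" if "x \<in> carrier R" for x by (rule ring_hom_closed[OF f that])
  have g_to: "fractions_map R S (to_fractions R x) = ?f x" if "x \<in> carrier R" for x
    using that g_frac[of x \<one>] ring_hom_one[OF f] fc by (simp add: to_fractions_def loc_map_def)
  have UT: "fractions_map R S ` to_fractions R ` S \<subseteq> Units ?Q"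
    using U by (auto simp: g_to)
  have ab: "mk_frac R ?N a b \<in> carrier (total_fractions R)"
    using assms by (simp add: total_fractions_def)
  have "loc_total_map R S (mk_frac (total_fractions R) (to_fractions R ` S)
      (mk_frac R ?N a b) (to_fractions R s)) = ?f a \<otimes>\<^bsub>?Q\<^esub> inv\<^bsub>?Q\<^esub> (?f b) \<otimes>\<^bsub>?Q\<^esub> inv\<^bsub>?Q\<^esub> (?f s)"
    unfolding loc_total_map_def
    using T.loc_lift_frac[OF Q.is_cring g UT ab, of "to_fractions R s"] assms
    by (simp add: g_frac g_to)
  also have "\<dots> = mk_frac ?L (nonzerodivisors ?L) (loc_map R S a)
      (loc_map R S b \<otimes>\<^bsub>?L\<^esub> loc_map R S s)"
    using assms nL ring_hom_closed[OF loc_map_hom]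
    by (simp add: inv_f) (simp add: to_fractions_def total_fractions_def loc_map_def[of ?L] NL.frac_mult)
  finally show ?thesis using assms by (simp add: ring_hom_mult[OF loc_map_hom])
qed

end

theory Submission
  imports Defs
begin

text \<open>Fix \<open>x\<close> in the normalization of \<open>A\<close> and let \<open>M\<close> be the sum of the rings \<open>B i\<close>. The elements \<open>a\<close> of
\<open>A\<close> with \<open>a x \<in> M\<close> form an ideal, and \<open>x \<in> M\<close> as soon as this ideal is not contained in any prime.
So for each prime \<open>P\<close> one has to find \<open>u \<notin> P\<close> with \<open>u x \<in> M\<close>. If \<open>P\<close> is singular, it lies in a
stratum \<open>V i\<close>, and the hypothesis at \<open>P\<close> writes \<open>x\<close> as \<open>b/s\<close> with \<open>b \<in> B i\<close> and \<open>s \<notin> P\<close>, after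
localization; clearing the remaining denominator gives \<open>u\<close> (\<open>denominator_of_local_equality\<close>). If
\<open>P\<close> is not singular, the local ring at \<open>P\<close> is regular, hence normal, so it contains \<open>x\<close>, and
\<open>u x \<in> A \<subseteq> B 1\<close> for some \<open>u \<notin> P\<close> (\<open>regular_point_denominator\<close>). The other inclusion says that
the normalization is closed under addition: over a Noetherian ring, \<open>x\<close> is integral if and only if
all its powers have a common denominator, and this property passes to sums (\<open>integral_add\<close>).

The substance is that a regular local ring is normal (\<open>regular_local_ring_normal\<close>). Let the maximal
ideal \<open>m\<close> be generated by as many elements as a chain of primes \<open>p = p\<^sub>0 \<subset> \<dots> \<subset> p\<^sub>n = m\<close> has steps.
Pick a generator \<open>x\<close> outside \<open>p\<close>. By Krull's principal ideal theorem the chain can be deformed to a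
chain with one step less that starts at a prime \<open>p' \<supseteq> p\<close> containing \<open>x\<close>. In \<open>R/(x)\<close> the maximal
ideal needs one generator less, so by induction \<open>p' = (x)\<close> and \<open>R/(x)\<close> is a normal domain. Each
element of \<open>p \<subseteq> (x)\<close> is \<open>x r\<close> with \<open>r \<in> p\<close>, so \<open>p = 0\<close> by Nakayama. Normality then lifts from \<open>R/(x)\<close> to
\<open>R\<close> (\<open>normal_modulo_lift\<close>).

Two devices keep this inside one ring. Quotients \<open>R/K\<close> are replaced by statements modulo an ideal
\<open>K\<close> of \<open>R\<close>; in particular \<open>normal_modulo R K\<close> expresses that \<open>R/K\<close> is a completely integrally closed
domain. Localizations at a prime \<open>P\<close> are replaced by ideals that are saturated with respect to the
complement of \<open>P\<close>. All finiteness enters through the existence of maximal members in sets of ideals.\<close>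

section \<open>Ideals, colon ideals and saturation\<close>

lemma (in cring) ideal_intro:
  assumes "I \<subseteq> carrier R" and "\<zero> \<in> I"
    and "\<And>a b. a \<in> I \<Longrightarrow> b \<in> I \<Longrightarrow> a \<oplus> b \<in> I"
    and mult: "\<And>r a. r \<in> carrier R \<Longrightarrow> a \<in> I \<Longrightarrow> r \<otimes> a \<in> I"
  shows "ideal I R"
proof (rule idealI[OF ring_axioms])
  show "subgroup I (add_monoid R)"
  proof (rule add.subgroupI)
    show "\<ominus> a \<in> I" if "a \<in> I" for a
      using mult[of "\<ominus> \<one>" a] that assms(1) by (auto simp: l_minus)
  qed (use assms in auto)
  show "a \<otimes> x \<in> I" if "a \<in> I" "x \<in> carrier R" for a x
    using mult[of x a] that assms(1) by (metis m_comm subsetD)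
qed (use assms in auto)

lemma ideal_memD:
  fixes R (structure)
  assumes "ideal I R"
  shows "a \<in> I \<Longrightarrow> a \<in> carrier R"
    and "\<zero> \<in> I"
    and "a \<in> I \<Longrightarrow> b \<in> I \<Longrightarrow> a \<oplus> b \<in> I"
    and "a \<in> I \<Longrightarrow> b \<in> I \<Longrightarrow> a \<ominus> b \<in> I"
    and "r \<in> carrier R \<Longrightarrow> a \<in> I \<Longrightarrow> r \<otimes> a \<in> I"
    and "r \<in> carrier R \<Longrightarrow> a \<in> I \<Longrightarrow> a \<otimes> r \<in> I"
proof -
  interpret ideal I R by fact
  show "a \<in> I \<Longrightarrow> a \<in> carrier R" "\<zero> \<in> I" "a \<in> I \<Longrightarrow> b \<in> I \<Longrightarrow> a \<oplus> b \<in> I"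
    "r \<in> carrier R \<Longrightarrow> a \<in> I \<Longrightarrow> r \<otimes> a \<in> I"
    "r \<in> carrier R \<Longrightarrow> a \<in> I \<Longrightarrow> a \<otimes> r \<in> I"
    by (auto intro: I_l_closed I_r_closed)
  show "a \<in> I \<Longrightarrow> b \<in> I \<Longrightarrow> a \<ominus> b \<in> I"
    unfolding a_minus_def by auto
qed

lemma primeideal_memD:
  fixes R (structure)
  assumes "primeideal P R"
  shows "ideal P R" and "\<one> \<notin> P" and "P \<subseteq> carrier R" and "P \<noteq> carrier R"
    and "a \<in> carrier R \<Longrightarrow> b \<in> carrier R \<Longrightarrow> a \<otimes> b \<in> P \<Longrightarrow> a \<in> P \<or> b \<in> P"
proof -
  interpret primeideal P R by fact
  show "ideal P R" "\<one> \<notin> P" "P \<subseteq> carrier R" "P \<noteq> carrier R"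
    using is_ideal I_notcarr one_imp_carrier a_subset by auto
  show "a \<in> carrier R \<Longrightarrow> b \<in> carrier R \<Longrightarrow> a \<otimes> b \<in> P \<Longrightarrow> a \<in> P \<or> b \<in> P"
    by (rule I_prime)
qed

lemma (in cring) prime_power_notin:
  assumes "primeideal P R" "y \<in> carrier R" "y \<notin> P"
  shows "y [^] (n::nat) \<notin> P"
proof (induction n)
  case 0 then show ?case using primeideal_memD(2)[OF assms(1)] by simp
next
  case (Suc n)
  then show ?case using primeideal_memD(5)[OF assms(1), of "y [^] n" y] assms by auto
qed

definition colon :: "('a, 'm) ring_scheme \<Rightarrow> 'a set \<Rightarrow> 'a \<Rightarrow> 'a set" where
  "colon R I x = {a \<in> carrier R. x \<otimes>\<^bsub>R\<^esub> a \<in> I}"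

lemma (in cring) ideal_colon:
  assumes "ideal I R" "x \<in> carrier R"
  shows "ideal (colon R I x) R" "I \<subseteq> colon R I x"
proof -
  note I = ideal_memD[OF assms(1)]
  show "ideal (colon R I x) R"
  proof (rule ideal_intro)
    show "r \<otimes> a \<in> colon R I x" if "r \<in> carrier R" "a \<in> colon R I x" for r a
      using that assms(2) I(5)[of r "x \<otimes> a"] by (auto simp: colon_def m_lcomm)
  qed (use I assms in \<open>auto simp: colon_def r_distr\<close>)
  show "I \<subseteq> colon R I x" using I assms(2) by (auto simp: colon_def)
qed

definition ideal_plus :: "('a, 'm) ring_scheme \<Rightarrow> 'a set \<Rightarrow> 'a \<Rightarrow> 'a set" where
  "ideal_plus R I x = {i \<oplus>\<^bsub>R\<^esub> x \<otimes>\<^bsub>R\<^esub> r | i r. i \<in> I \<and> r \<in> carrier R}"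

lemma (in cring) ideal_ideal_plus:
  assumes "ideal I R" "x \<in> carrier R"
  shows "ideal (ideal_plus R I x) R" "I \<subseteq> ideal_plus R I x" "x \<in> ideal_plus R I x"
proof -
  note I = ideal_memD[OF assms(1)]
  show 1: "I \<subseteq> ideal_plus R I x"
  proof
    fix i assume "i \<in> I"
    then have "i = i \<oplus> x \<otimes> \<zero>" "i \<in> I" using I assms by auto
    then show "i \<in> ideal_plus R I x" unfolding ideal_plus_def by blast
  qed
  have "x = \<zero> \<oplus> x \<otimes> \<one>" using assms by auto
  then show "x \<in> ideal_plus R I x" unfolding ideal_plus_def using I(2) by blast
  show "ideal (ideal_plus R I x) R"
  proof (rule ideal_intro)
    show "ideal_plus R I x \<subseteq> carrier R" using I assms by (auto simp: ideal_plus_def)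
    show "\<zero> \<in> ideal_plus R I x" using 1 I(2) by auto
  next
    fix a b assume "a \<in> ideal_plus R I x" "b \<in> ideal_plus R I x"
    then obtain i r j t where h: "a = i \<oplus> x \<otimes> r" "i \<in> I" "r \<in> carrier R"
      "b = j \<oplus> x \<otimes> t" "j \<in> I" "t \<in> carrier R"
      unfolding ideal_plus_def by blast
    have "a \<oplus> b = (i \<oplus> j) \<oplus> x \<otimes> (r \<oplus> t)"
      unfolding h using h(3,6) I(1)[OF h(2)] I(1)[OF h(5)] assms(2) by algebra
    then show "a \<oplus> b \<in> ideal_plus R I x"
      unfolding ideal_plus_def using h I(3)[OF h(2,5)] by blast
  next
    fix s a assume s: "s \<in> carrier R" and "a \<in> ideal_plus R I x"
    then obtain i r where h: "a = i \<oplus> x \<otimes> r" "i \<in> I" "r \<in> carrier R"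
      unfolding ideal_plus_def by blast
    have "s \<otimes> a = (s \<otimes> i) \<oplus> x \<otimes> (s \<otimes> r)"
      unfolding h using h(3) I(1)[OF h(2)] assms(2) s by algebra
    then show "s \<otimes> a \<in> ideal_plus R I x"
      unfolding ideal_plus_def using h s I(5)[OF s h(2)] by blast
  qed
qed

lemma (in cring) ideal_plus_least:
  assumes "ideal J R" "I \<subseteq> J" "x \<in> J"
  shows "ideal_plus R I x \<subseteq> J"
  using assms(2,3) ideal_memD[OF assms(1)] unfolding ideal_plus_def by auto

text \<open>The contraction to \<open>R\<close> of the extension of \<open>I\<close> to the local ring at \<open>P\<close>. The saturated ideals
correspond to the ideals of that local ring.\<close>

definition saturation :: "('a, 'm) ring_scheme \<Rightarrow> 'a set \<Rightarrow> 'a set \<Rightarrow> 'a set" where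
  "saturation R P I = {a \<in> carrier R. \<exists>t\<in>carrier R - P. t \<otimes>\<^bsub>R\<^esub> a \<in> I}"

definition saturated :: "('a, 'm) ring_scheme \<Rightarrow> 'a set \<Rightarrow> 'a set \<Rightarrow> bool" where
  "saturated R P I \<longleftrightarrow> (\<forall>t\<in>carrier R - P. \<forall>a\<in>carrier R. t \<otimes>\<^bsub>R\<^esub> a \<in> I \<longrightarrow> a \<in> I)"

lemma (in cring) ideal_saturation:
  assumes P: "primeideal P R" and "ideal I R"
  shows "ideal (saturation R P I) R" "I \<subseteq> saturation R P I" "saturated R P (saturation R P I)"
proof -
  note I = ideal_memD[OF assms(2)] and P = primeideal_memD[OF P]
  show 1: "I \<subseteq> saturation R P I"
    using I P(2) unfolding saturation_def by force
  have prod: "t \<otimes> u \<in> carrier R - P" if "t \<in> carrier R - P" "u \<in> carrier R - P" for t u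
    using P(5)[of t u] that by auto
  show "ideal (saturation R P I) R"
  proof (rule ideal_intro)
    show "saturation R P I \<subseteq> carrier R" by (auto simp: saturation_def)
    show "\<zero> \<in> saturation R P I" using 1 I(2) by auto
  next
    fix a b assume "a \<in> saturation R P I" "b \<in> saturation R P I"
    then obtain t u where h: "a \<in> carrier R" "b \<in> carrier R" "t \<in> carrier R - P" "u \<in> carrier R - P"
      "t \<otimes> a \<in> I" "u \<otimes> b \<in> I"
      unfolding saturation_def by blast
    have "(t \<otimes> u) \<otimes> (a \<oplus> b) = u \<otimes> (t \<otimes> a) \<oplus> t \<otimes> (u \<otimes> b)"
      using h by (simp add: r_distr m_ac)
    also have "\<dots> \<in> I" using h I by auto
    finally show "a \<oplus> b \<in> saturation R P I"
      unfolding saturation_def using h prod[OF h(3,4)] by blast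
  next
    fix s a assume s: "s \<in> carrier R" and "a \<in> saturation R P I"
    then obtain t where h: "a \<in> carrier R" "t \<in> carrier R - P" "t \<otimes> a \<in> I"
      unfolding saturation_def by blast
    have "t \<otimes> (s \<otimes> a) = s \<otimes> (t \<otimes> a)" using h s by (simp add: m_ac)
    then show "s \<otimes> a \<in> saturation R P I"
      unfolding saturation_def using h s I(5)[OF s h(3)] by (auto intro!: bexI[of _ t])
  qed
  show "saturated R P (saturation R P I)"
    unfolding saturated_def
  proof (intro ballI impI)
    fix t a assume t: "t \<in> carrier R - P" "a \<in> carrier R" "t \<otimes> a \<in> saturation R P I"
    then obtain u where u: "u \<in> carrier R - P" "u \<otimes> (t \<otimes> a) \<in> I" unfolding saturation_def by blast
    then have "(u \<otimes> t) \<otimes> a \<in> I" using t by (simp add: m_assoc)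
    then show "a \<in> saturation R P I" unfolding saturation_def using t prod[OF u(1) t(1)] by blast
  qed
qed

lemma saturatedD:
  "saturated R P I \<Longrightarrow> t \<in> carrier R \<Longrightarrow> t \<notin> P \<Longrightarrow> a \<in> carrier R \<Longrightarrow> t \<otimes>\<^bsub>R\<^esub> a \<in> I \<Longrightarrow> a \<in> I"
  by (auto simp: saturated_def)

lemma saturation_mono: "I \<subseteq> J \<Longrightarrow> saturation R P I \<subseteq> saturation R P J"
  by (auto simp: saturation_def)

lemma saturation_saturated: "saturated R P I \<Longrightarrow> saturation R P I \<subseteq> I"
  unfolding saturated_def saturation_def by blast

section \<open>Noetherian rings\<close>

locale noetherian_cring = cring R + noetherian_ring R for R (structure)

context noetherian_cring
begin

lemma maximal_ideal_in_set:
  assumes "I0 \<in> F" and ideals: "\<And>I. I \<in> F \<Longrightarrow> ideal I R"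
  obtains I where "I \<in> F" "I0 \<subseteq> I" "\<And>J. J \<in> F \<Longrightarrow> I \<subseteq> J \<Longrightarrow> J = I"
proof -
  let ?F = "{I \<in> F. I0 \<subseteq> I}"
  have "\<exists>I\<in>?F. \<forall>J\<in>?F. I \<subseteq> J \<longrightarrow> J = I"
  proof (rule subset_Zorn)
    fix C assume C: "subset.chain ?F C"
    show "\<exists>U\<in>?F. \<forall>D\<in>C. D \<subseteq> U"
    proof (cases "C = {}")
      case True then show ?thesis using assms(1) by auto
    next
      case False
      have "subset.chain {I. ideal I R} C"
        using C ideals unfolding subset_chain_def by auto
      from ideal_chain_is_trivial[OF False this] have "\<Union>C \<in> C" .
      moreover have "C \<subseteq> ?F" using C unfolding subset_chain_def by simp
      ultimately show ?thesis by (intro bexI[of _ "\<Union>C"]) auto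
    qed
  qed
  then obtain I where "I \<in> ?F" "\<forall>J\<in>?F. I \<subseteq> J \<longrightarrow> J = I" by blast
  then show thesis using that[of I] by blast
qed

text \<open>A form of Nakayama's lemma at \<open>P\<close> for a mere set \<open>W\<close>: if, locally at \<open>P\<close>, each element of \<open>W\<close> is
modulo \<open>N\<close> a multiple, by a factor from \<open>P\<close>, of another element of \<open>W\<close>, then \<open>W \<subseteq> N\<close>. Among the
ideals \<open>N + wR\<close>, saturated at \<open>P\<close>, with \<open>w \<in> W\<close> outside \<open>N\<close>, take a maximal one. The element \<open>w'\<close>
with \<open>t w \<equiv> y w'\<close> generates a larger such ideal, hence the same one, so \<open>u w' \<equiv> r w\<close> with
\<open>u \<notin> P\<close>. Then \<open>(u t - y r) w \<in> N\<close>, where \<open>u t - y r \<notin> P\<close>. Allowing a set that is not an ideal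
matters in the applications to sets of numerators below.\<close>

lemma nakayama:
  assumes P: "primeideal P R" and N: "ideal N R" "saturated R P N"
    and W: "W \<subseteq> carrier R"
    and step: "\<And>w. w \<in> W \<Longrightarrow>
      \<exists>t\<in>carrier R - P. \<exists>y\<in>P. \<exists>w'\<in>W. t \<otimes> w \<ominus> y \<otimes> w' \<in> N"
  shows "W \<subseteq> N"
proof (rule ccontr)
  assume "\<not> W \<subseteq> N"
  then obtain w0 where w0: "w0 \<in> W" "w0 \<notin> N" by blast
  note Pm = primeideal_memD[OF P] and Nm = ideal_memD[OF N(1)]
  note pid = ideal_memD[OF Pm(1)]
  define E where "E w = saturation R P (ideal_plus R N w)" for w
  have Eid: "ideal (E w) R" "N \<subseteq> E w" "w \<in> E w" if "w \<in> carrier R" for w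
    unfolding E_def using ideal_ideal_plus[OF N(1) that]
      ideal_saturation(1,2)[OF P ideal_ideal_plus(1)[OF N(1) that]] by auto
  obtain I where I: "I \<in> E ` (W - N)" and max: "\<And>J. J \<in> E ` (W - N) \<Longrightarrow> I \<subseteq> J \<Longrightarrow> J = I"
    by (rule maximal_ideal_in_set[of "E w0" "E ` (W - N)"]) (use w0 Eid W in auto)
  then obtain w where w: "w \<in> W" "w \<notin> N" "I = E w" by blast
  obtain t y w' where s: "t \<in> carrier R - P" "y \<in> P" "w' \<in> W" and tw: "t \<otimes> w \<ominus> y \<otimes> w' \<in> N"
    using step[OF w(1)] by blast
  have c: "w \<in> carrier R" "w' \<in> carrier R" "t \<in> carrier R" "y \<in> carrier R"
    using s w W pid by auto
  have tw_eq: "t \<otimes> w = (t \<otimes> w \<ominus> y \<otimes> w') \<oplus> y \<otimes> w'" using c by algebra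
  have "w' \<notin> N"
  proof
    assume "w' \<in> N"
    then have "t \<otimes> w \<in> N" using tw tw_eq Nm c by metis
    then show False using N(2) s w c unfolding saturated_def by blast
  qed
  moreover have "E w \<subseteq> E w'"
  proof
    fix a assume "a \<in> E w"
    then obtain u n r where h: "a \<in> carrier R" "u \<in> carrier R - P" "u \<otimes> a = n \<oplus> w \<otimes> r" "n \<in> N" "r \<in> carrier R"
      unfolding E_def saturation_def ideal_plus_def by blast
    have n: "n \<in> carrier R" using h Nm by auto
    have "(t \<otimes> u) \<otimes> a = t \<otimes> (u \<otimes> a)" using h c by (simp add: m_assoc)
    also have "\<dots> = t \<otimes> n \<oplus> r \<otimes> (t \<otimes> w)" unfolding h(3) using h(5) c n by algebra
    also have "\<dots> = t \<otimes> n \<oplus> r \<otimes> ((t \<otimes> w \<ominus> y \<otimes> w') \<oplus> y \<otimes> w')" using tw_eq by simp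
    also have "\<dots> = (t \<otimes> n \<oplus> r \<otimes> (t \<otimes> w \<ominus> y \<otimes> w')) \<oplus> w' \<otimes> (r \<otimes> y)" using h(5) c n by algebra
    finally have "(t \<otimes> u) \<otimes> a = (t \<otimes> n \<oplus> r \<otimes> (t \<otimes> w \<ominus> y \<otimes> w')) \<oplus> w' \<otimes> (r \<otimes> y)" .
    moreover have "t \<otimes> n \<oplus> r \<otimes> (t \<otimes> w \<ominus> y \<otimes> w') \<in> N" using Nm tw h c by auto
    moreover have "t \<otimes> u \<in> carrier R - P" using Pm(5)[of t u] s h by auto
    ultimately show "a \<in> E w'"
      unfolding E_def saturation_def ideal_plus_def using h c by blast
  qed
  ultimately have "E w' = E w" using max[of "E w'"] s w by blast
  then have "w' \<in> E w" using Eid(3)[OF c(2)] by simp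
  then obtain u n r where h: "u \<in> carrier R - P" "u \<otimes> w' = n \<oplus> w \<otimes> r" "n \<in> N" "r \<in> carrier R"
    unfolding E_def saturation_def ideal_plus_def by blast
  have n: "n \<in> carrier R" using h Nm by auto
  have uc: "u \<in> carrier R" using h by auto
  \<comment> \<open>substitute \<open>u w\' = n + w r\<close> into \<open>t w - y w\' \<in> N\<close>; the factor of \<open>w\<close> is a unit at \<open>P\<close>\<close>
  have "(u \<otimes> t \<ominus> y \<otimes> r) \<otimes> w = u \<otimes> (t \<otimes> w \<ominus> y \<otimes> w') \<oplus> (y \<otimes> (u \<otimes> w') \<ominus> y \<otimes> (r \<otimes> w))"
    using c uc h(4) by algebra
  also have "\<dots> = u \<otimes> (t \<otimes> w \<ominus> y \<otimes> w') \<oplus> y \<otimes> n"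
  proof -
    have "y \<otimes> (n \<oplus> w \<otimes> r) \<ominus> y \<otimes> (r \<otimes> w) = y \<otimes> n" using c h(4) n by algebra
    then show ?thesis unfolding h(2) by simp
  qed
  also have "\<dots> \<in> N" using Nm tw h c uc by auto
  finally have in_N: "(u \<otimes> t \<ominus> y \<otimes> r) \<otimes> w \<in> N" .
  have "u \<otimes> t \<ominus> y \<otimes> r \<notin> P"
  proof
    assume "u \<otimes> t \<ominus> y \<otimes> r \<in> P"
    moreover have "y \<otimes> r \<in> P" using pid s h by auto
    moreover have "u \<otimes> t = (u \<otimes> t \<ominus> y \<otimes> r) \<oplus> y \<otimes> r" using uc c h(4) by algebra
    ultimately have "u \<otimes> t \<in> P" using pid(3) by metis
    then show False using Pm(5)[of u t] h s by auto
  qed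
  then show False using N(2) in_N w c uc h unfolding saturated_def by auto
qed

text \<open>The colon ideals of \<open>I\<close> by elements outside \<open>I\<close> have a maximal member, and such a maximal one is
prime.\<close>

lemma exists_associated_prime:
  assumes I: "ideal I R" "I \<noteq> carrier R"
  obtains a where "a \<in> carrier R" "a \<notin> I" "primeideal (colon R I a) R"
proof -
  note Im = ideal_memD[OF I(1)]
  have "\<one> \<notin> I" using ideal.one_imp_carrier[OF I(1)] I(2) by blast
  then have "colon R I \<one> \<in> colon R I ` (carrier R - I)" by auto
  then obtain J where J: "J \<in> colon R I ` (carrier R - I)"
    and max: "\<And>J'. J' \<in> colon R I ` (carrier R - I) \<Longrightarrow> J \<subseteq> J' \<Longrightarrow> J' = J"
    by (rule maximal_ideal_in_set) (use ideal_colon I in auto)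
  then obtain a where a: "a \<in> carrier R" "a \<notin> I" "J = colon R I a" by blast
  have "primeideal (colon R I a) R"
  proof (rule primeidealI)
    show "ideal (colon R I a) R" using ideal_colon I a by auto
    have "\<one> \<notin> colon R I a" using a by (auto simp: colon_def)
    then show "carrier R \<noteq> colon R I a" by auto
  next
    fix u v assume uv: "u \<in> carrier R" "v \<in> carrier R" "u \<otimes> v \<in> colon R I a"
    show "u \<in> colon R I a \<or> v \<in> colon R I a"
    proof (rule disjCI)
      assume "v \<notin> colon R I a"
      then have v: "a \<otimes> v \<notin> I" using uv by (auto simp: colon_def)
      have "colon R I a \<subseteq> colon R I (a \<otimes> v)"
      proof
        fix z assume "z \<in> colon R I a"
        then have z: "z \<in> carrier R" "a \<otimes> z \<in> I" by (auto simp: colon_def)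
        have "a \<otimes> v \<otimes> z = v \<otimes> (a \<otimes> z)" using z a uv by (simp add: m_ac)
        then show "z \<in> colon R I (a \<otimes> v)" using z uv Im by (auto simp: colon_def)
      qed
      then have "colon R I (a \<otimes> v) = colon R I a" using max[of "colon R I (a \<otimes> v)"] a v uv by auto
      moreover have "a \<otimes> v \<otimes> u = a \<otimes> (u \<otimes> v)" using uv a by (simp add: m_ac)
      then have "u \<in> colon R I (a \<otimes> v)" using uv by (auto simp: colon_def)
      ultimately show "u \<in> colon R I a" by simp
    qed
  qed (rule is_cring)
  then show thesis using that a by blast
qed

end

section \<open>Krull's principal ideal theorem and chains of primes\<close>

context noetherian_cring
begin

text \<open>If \<open>P\<close> is the only prime between \<open>J0\<close> and \<open>P\<close>, the local ring of \<open>R/J0\<close> at \<open>P\<close> is Artinian. By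
Noetherian induction, take \<open>L\<close> maximal among the saturated ideals above which some descending chain
fails to stabilize. An associated prime of \<open>L\<close> lies between \<open>J0\<close> and \<open>P\<close>, so it is \<open>P\<close>, and there is \<open>a\<close>
with \<open>(L : a) = P\<close>. Hence no saturated ideal lies strictly between \<open>L\<close> and \<open>J\<close>, the saturation of
\<open>L + aR\<close>. Above \<open>J\<close> chains do stabilize, so the sums of the members of the chain with \<open>J\<close> do, and
their intersections with \<open>J\<close> are eventually \<open>L\<close>; the modular law makes the chain stable.\<close>

lemma saturated_chain_stabilizes:
  assumes P: "primeideal P R" and J0: "ideal J0 R"
    and isolated: "\<And>q. primeideal q R \<Longrightarrow> J0 \<subseteq> q \<Longrightarrow> q \<subseteq> P \<Longrightarrow> q = P"
    and chain: "\<And>j::nat. ideal (c j) R" "\<And>j. saturated R P (c j)" "\<And>j. J0 \<subseteq> c j"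
      "\<And>j. c (Suc j) \<subseteq> c j"
  shows "\<exists>N. \<forall>j\<ge>N. c j = c N"
proof (rule ccontr)
  assume unstable: "\<not> ?thesis"
  note Pm = primeideal_memD[OF P]
  define bad where "bad L \<longleftrightarrow> (\<exists>c :: nat \<Rightarrow> 'a set.
    (\<forall>j. ideal (c j) R \<and> saturated R P (c j) \<and> L \<subseteq> c j \<and> c (Suc j) \<subseteq> c j) \<and>
    \<not> (\<exists>N. \<forall>j\<ge>N. c j = c N))" for L
  define F where "F = {L. ideal L R \<and> saturated R P L \<and> J0 \<subseteq> L \<and> bad L}"
  have "saturation R P J0 \<subseteq> c j" for j
    using saturation_mono[OF chain(3)[of j]] saturation_saturated[OF chain(2)[of j]] by (rule subset_trans)
  then have "bad (saturation R P J0)"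
    unfolding bad_def using chain unstable by blast
  then have "saturation R P J0 \<in> F"
    unfolding F_def using ideal_saturation[OF P J0] by simp
  then obtain L where L: "L \<in> F" and max: "\<And>L'. L' \<in> F \<Longrightarrow> L \<subseteq> L' \<Longrightarrow> L' = L"
    by (rule maximal_ideal_in_set) (auto simp: F_def)
  have Lid: "ideal L R" and Lsat: "saturated R P L" and L0: "J0 \<subseteq> L" and "bad L"
    using L by (auto simp: F_def)
  note Lm = ideal_memD[OF Lid]
  from \<open>bad L\<close> obtain d where d: "\<And>j::nat. ideal (d j) R" "\<And>j. saturated R P (d j)" "\<And>j. L \<subseteq> d j"
      "\<And>j. d (Suc j) \<subseteq> d j" and d_unstable: "\<not> (\<exists>N. \<forall>j\<ge>N. d j = d N)"
    unfolding bad_def by blast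
  have d_anti: "d j \<subseteq> d i" if "i \<le> j" for i j using d(4) that by (rule lift_Suc_antimono_le)
  note dm = ideal_memD[OF d(1)]
  have "L \<noteq> carrier R"
  proof
    assume "L = carrier R"
    then have "d j = carrier R" for j using d(3)[of j] dm(1)[of _ j] by blast
    then show False using d_unstable by simp
  qed
  then obtain a where a: "a \<in> carrier R" "a \<notin> L" and qa: "primeideal (colon R L a) R"
    using exists_associated_prime[OF Lid] by blast
  have "colon R L a \<subseteq> P"
  proof
    fix t assume "t \<in> colon R L a"
    then have "t \<in> carrier R" "t \<otimes> a \<in> L" using a by (auto simp: colon_def m_comm)
    then show "t \<in> P" using saturatedD[OF Lsat, of t a] a by blast
  qed
  then have colon_P: "colon R L a = P"
    using isolated[OF qa] ideal_colon(2)[OF Lid a(1)] L0 by blast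
  define J where "J = saturation R P (ideal_plus R L a)"
  note La = ideal_ideal_plus[OF Lid a(1)]
  have J: "ideal J R" "saturated R P J" "L \<subseteq> J" "a \<in> J"
    unfolding J_def using ideal_saturation[OF P La(1)] La by auto
  have not_bad: "\<not> bad J"
    using max[of J] J L0 a by (auto simp: F_def)
  have J_le: "J \<subseteq> d j" if "a \<in> d j" for j
    using saturation_mono[OF ideal_plus_least[OF d(1)[of j] d(3) that]]
      saturation_saturated[OF d(2)[of j]] unfolding J_def by blast
  \<comment> \<open>a chain whose members all contain \<open>a\<close> is a chain above \<open>J\<close>\<close>
  obtain j0 where j0: "a \<notin> d j0"
  proof (rule ccontr)
    assume "\<not> thesis"
    then have "a \<in> d j" for j using that by blast
    then have "bad J" unfolding bad_def using J_le d d_unstable by blast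
    then show False using not_bad by blast
  qed
  have small: "l \<in> L" if l: "l \<in> d j" "l \<in> J" "j0 \<le> j" for j l
  proof -
    obtain t i r where h: "l \<in> carrier R" "t \<in> carrier R - P" "t \<otimes> l = i \<oplus> a \<otimes> r" "i \<in> L" "r \<in> carrier R"
      using l(2) unfolding J_def saturation_def ideal_plus_def by blast
    have ic: "i \<in> carrier R" using h Lm by blast
    have "r \<in> P"
    proof (rule ccontr)
      assume "r \<notin> P"
      have "r \<otimes> a = (i \<oplus> a \<otimes> r) \<ominus> i" using h(5) a ic by algebra
      also have "\<dots> = t \<otimes> l \<ominus> i" using h by simp
      also have "\<dots> \<in> d j"
        using dm(4)[OF dm(5)[OF _ l(1), of t], of i] h(2,4) d(3)[of j] by auto
      finally have "a \<in> d j" by (rule saturatedD[OF d(2) h(5) \<open>r \<notin> P\<close> a(1)])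
      then show False using j0 d_anti[OF l(3)] by blast
    qed
    then have "a \<otimes> r \<in> L" unfolding colon_P[symmetric] by (simp add: colon_def)
    then have "t \<otimes> l \<in> L" unfolding h(3) using h(4) Lm by blast
    then show ?thesis using saturatedD[OF Lsat] h by blast
  qed
  define K where "K j = saturation R P (d j <+> J)" for j
  have dJ: "ideal (d j <+> J) R" for j using add_ideals[OF d(1) J(1)] .
  have K: "ideal (K j) R" "saturated R P (K j)" "d j <+> J \<subseteq> K j" for j
    unfolding K_def using ideal_saturation[OF P dJ] by auto
  have "J \<subseteq> d j <+> J" for j
  proof
    fix z assume "z \<in> J"
    moreover have "z = \<zero> \<oplus> z" using ideal_memD(1)[OF J(1) \<open>z \<in> J\<close>] by simp
    ultimately show "z \<in> d j <+> J" using dm(2)[of j] unfolding set_add_def' by blast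
  qed
  then have KJ: "J \<subseteq> K j" for j using K(3)[of j] by blast
  have K4: "K (Suc j) \<subseteq> K j" for j
    unfolding K_def by (rule saturation_mono) (use d(4)[of j] in \<open>auto simp: set_add_def'\<close>)
  obtain N1 where N1: "\<And>j. j \<ge> N1 \<Longrightarrow> K j = K N1"
    using not_bad K(1,2) KJ K4 unfolding bad_def by blast
  define N where "N = max N1 j0"
  have "d j = d N" if "N \<le> j" for j
  proof
    show "d j \<subseteq> d N" by (rule d_anti[OF that])
    show "d N \<subseteq> d j"
    proof
      fix z assume z: "z \<in> d N"
      have zc: "z \<in> carrier R" using z dm by blast
      have "z = z \<oplus> \<zero>" using zc by simp
      then have "z \<in> d N <+> J" using z ideal_memD(2)[OF J(1)] unfolding set_add_def' by blast
      then have "z \<in> K j" using K(3)[of N] N1[of N] N1[of j] that unfolding N_def by auto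
      then obtain t w v where h: "t \<in> carrier R - P" "t \<otimes> z = w \<oplus> v" "w \<in> d j" "v \<in> J"
        unfolding K_def saturation_def set_add_def' by blast
      have wv: "w \<in> carrier R" "v \<in> carrier R" using h(3,4) dm(1) ideal_memD(1)[OF J(1)] by auto
      have "v = (w \<oplus> v) \<ominus> w" using wv by algebra
      also have "\<dots> = t \<otimes> z \<ominus> w" using h by simp
      also have "\<dots> \<in> d N" 
        using dm(4)[OF dm(5)[OF _ z, of t], of w] h(1,3) d_anti[OF that] by auto
      finally have "v \<in> L" using small[of v N] h(4) unfolding N_def by simp
      then have "t \<otimes> z \<in> d j" unfolding h(2) using h(3) d(3)[of j] dm(3) by blast
      then show "z \<in> d j" using saturatedD[OF d(2)] h(1) zc by blast
    qed
  qed
  then show False using d_unstable by blast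
qed

text \<open>Krull's principal ideal theorem, relative to \<open>p0\<close>: if no prime \<open>q \<subset> P\<close> contains both \<open>p0\<close> and \<open>x\<close>,
then saturated chains above \<open>p0 + xR\<close> stabilize. In the usual proof one uses the symbolic powers of
\<open>p1\<close>; here it suffices to take the powers of a single \<open>y \<in> p1\<close> outside \<open>p0\<close>. Let \<open>Q k\<close> be the
\<open>p1\<close>-saturation of \<open>p0 + y\<^sup>k R\<close>. Stability of \<open>Q k + xR\<close> and Nakayama give \<open>Q N = Q (N + 1)\<close>, so
\<open>s y\<^sup>N \<in> p0 + y\<^sup>N\<^sup>+\<^sup>1 R\<close> with \<open>s \<notin> p1\<close>. Cancelling \<open>y\<^sup>N\<close> modulo the prime \<open>p0\<close> puts \<open>s\<close> into
\<open>p0 + yR \<subseteq> p1\<close>, a contradiction.\<close>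

lemma principal_ideal_theorem:
  assumes p0: "primeideal p0 R" and p1: "primeideal p1 R" and P: "primeideal P R"
    and "p0 \<subset> p1" "p1 \<subset> P" and x: "x \<in> P" "x \<notin> p1"
  shows "\<exists>q. primeideal q R \<and> p0 \<subseteq> q \<and> q \<subset> P \<and> x \<in> q"
proof (rule ccontr)
  assume "\<not> ?thesis"
  then have no: "q = P" if "primeideal q R" "p0 \<subseteq> q" "q \<subseteq> P" "x \<in> q" for q
    using that by blast
  note p0m = primeideal_memD[OF p0] and p1m = primeideal_memD[OF p1] and Pm = primeideal_memD[OF P]
  obtain y where y: "y \<in> p1" "y \<notin> p0" using assms(4) by blast
  have c: "x \<in> carrier R" "y \<in> carrier R" using x y p1m Pm by auto
  define Q where "Q k = saturation R p1 (ideal_plus R p0 (y [^] k))" for k :: nat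
  have plus: "ideal (ideal_plus R p0 (y [^] k)) R" "p0 \<subseteq> ideal_plus R p0 (y [^] k)"
    "y [^] k \<in> ideal_plus R p0 (y [^] k)" for k :: nat
    using ideal_ideal_plus[OF p0m(1), of "y [^] k"] c by auto
  have Q: "ideal (Q k) R" "saturated R p1 (Q k)" "p0 \<subseteq> Q k" "y [^] k \<in> Q k" for k
    unfolding Q_def using ideal_saturation[OF p1 plus(1)] plus(2,3) by blast+
  note Qm = ideal_memD[OF Q(1)]
  have Q_anti: "Q (Suc k) \<subseteq> Q k" for k
    unfolding Q_def
  proof (rule saturation_mono[OF ideal_plus_least[OF plus(1) plus(2)]])
    show "y [^] Suc k \<in> ideal_plus R p0 (y [^] k)"
      using ideal_memD(6)[OF plus(1) c(2) plus(3)] by simp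
  qed
  have QP: "saturated R P (Q k)" for k
    using Q(2) assms(5) unfolding saturated_def by blast
  define J where "J k = saturation R P (ideal_plus R (Q k) x)" for k
  note Qx = ideal_ideal_plus[OF Q(1) c(1)]
  have J: "ideal (J k) R" "saturated R P (J k)" "Q k \<subseteq> J k" "x \<in> J k" for k
    unfolding J_def using ideal_saturation[OF P Qx(1)] Qx(2,3) by blast+
  have "J (Suc k) \<subseteq> J k" for k
    unfolding J_def using Q_anti Qx(2,3)
    by (intro saturation_mono ideal_plus_least[OF Qx(1)]) blast+
  moreover have "ideal_plus R p0 x \<subseteq> J k" for k
    by (rule ideal_plus_least[OF J(1)]) (use Q(3) J(3,4) in blast)+
  moreover have "q = P" if "primeideal q R" "ideal_plus R p0 x \<subseteq> q" "q \<subseteq> P" for q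
    by (rule no) (use that ideal_ideal_plus(2,3)[OF p0m(1) c(1)] in auto)
  ultimately obtain N where N: "\<And>j. N \<le> j \<Longrightarrow> J j = J N"
    using saturated_chain_stabilizes[OF P ideal_ideal_plus(1)[OF p0m(1) c(1)], of J] J by blast
  have "Q N \<subseteq> Q (Suc N)"
  proof (rule nakayama[OF P Q(1) QP])
    show "Q N \<subseteq> carrier R" using Qm by blast
    fix w assume w: "w \<in> Q N"
    then have "w \<in> J (Suc N)" using J(3)[of N] N[of "Suc N"] by auto
    then obtain t i r where h: "t \<in> carrier R - P" "t \<otimes> w = i \<oplus> x \<otimes> r" "i \<in> Q (Suc N)" "r \<in> carrier R"
      unfolding J_def saturation_def ideal_plus_def by blast
    have cc: "i \<in> carrier R" "w \<in> carrier R" using h w Qm by auto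
    have e: "t \<otimes> w \<ominus> x \<otimes> r = i" unfolding h(2) using cc h(4) c by algebra
    \<comment> \<open>\<open>x \<notin> p1\<close> can be cancelled because \<open>Q N\<close> is saturated at \<open>p1\<close>\<close>
    have "x \<otimes> r = (i \<oplus> x \<otimes> r) \<ominus> i" using cc h(4) c by algebra
    also have "\<dots> = t \<otimes> w \<ominus> i" using h by simp
    also have "\<dots> \<in> Q N"
      using Qm(4)[OF Qm(5)[OF _ w, of t], of i] h(1,3) Q_anti[of N] by auto
    finally have "r \<in> Q N" by (rule saturatedD[OF Q(2) c(1) x(2) h(4)])
    then show "\<exists>t\<in>carrier R - P. \<exists>y\<in>P. \<exists>w'\<in>Q N. t \<otimes> w \<ominus> y \<otimes> w' \<in> Q (Suc N)"
      using h(1,3) x(1) e by (intro bexI[of _ t] bexI[of _ x] bexI[of _ r]) auto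
  qed
  then have "y [^] N \<in> Q (Suc N)" using Q(4) by blast
  then obtain s i r where h: "s \<in> carrier R - p1" "s \<otimes> y [^] N = i \<oplus> y [^] Suc N \<otimes> r" "i \<in> p0" "r \<in> carrier R"
    unfolding Q_def saturation_def ideal_plus_def by blast
  have cc: "i \<in> carrier R" "s \<in> carrier R" "y [^] N \<in> carrier R" using h p0m c by auto
  have "y [^] N \<otimes> (s \<ominus> y \<otimes> r) = s \<otimes> y [^] N \<ominus> (y [^] N \<otimes> y) \<otimes> r"
    using cc h(4) c by algebra
  also have "\<dots> = (i \<oplus> (y [^] N \<otimes> y) \<otimes> r) \<ominus> (y [^] N \<otimes> y) \<otimes> r" using h by simp
  also have "\<dots> = i" using cc h(4) c by algebra
  finally have "s \<ominus> y \<otimes> r \<in> p0"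
    using p0m(5)[of "y [^] N" "s \<ominus> y \<otimes> r"] prime_power_notin[OF p0 c(2) y(2)] cc c h(3,4) by auto
  then have "s \<ominus> y \<otimes> r \<in> p1" using assms(4) by blast
  moreover have "y \<otimes> r \<in> p1" using ideal_memD(6)[OF p1m(1)] y h by blast
  moreover have "s = (s \<ominus> y \<otimes> r) \<oplus> y \<otimes> r" using cc c h(4) by algebra
  ultimately have "s \<in> p1" using ideal_memD(3)[OF p1m(1)] by metis
  then show False using h by blast
qed

end

inductive prime_chain :: "('a, 'm) ring_scheme \<Rightarrow> nat \<Rightarrow> 'a set \<Rightarrow> 'a set \<Rightarrow> bool" for R where
  start: "primeideal p R \<Longrightarrow> prime_chain R 0 p p"
| extend: "prime_chain R n p q \<Longrightarrow> primeideal q' R \<Longrightarrow> q \<subset> q' \<Longrightarrow> prime_chain R (Suc n) p q'"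

lemma prime_chainD:
  "prime_chain R n p q \<Longrightarrow> primeideal p R \<and> primeideal q R \<and> p \<subseteq> q \<and> (n > 0 \<longrightarrow> p \<noteq> q)"
  by (induction rule: prime_chain.induct) auto

text \<open>A chain from \<open>p\<close> to \<open>q\<close> can be pushed into the primes containing \<open>x \<in> q\<close> at the cost of one step.
If the last prime before \<open>q\<close> does not contain \<open>x\<close>, the principal ideal theorem, applied to the last
three primes, replaces it by one that does; then the chain below it is treated in the same way.\<close>

lemma (in noetherian_cring) prime_chain_through:
  assumes "prime_chain R (Suc n) p q" "x \<in> q" "x \<notin> p"
  shows "\<exists>p'. prime_chain R n p' q \<and> x \<in> p' \<and> p \<subseteq> p'"
  using assms
proof (induction n arbitrary: q)
  case 0
  from 0(1) have "primeideal q R \<and> p \<subseteq> q" using prime_chainD by blast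
  then show ?case using 0 prime_chain.start by blast
next
  case (Suc n)
  from Suc.prems(1) obtain q' where q': "prime_chain R (Suc n) p q'" "primeideal q R" "q' \<subset> q"
    by (cases rule: prime_chain.cases) auto
  have "\<exists>r. prime_chain R (Suc n) p r \<and> x \<in> r \<and> r \<subset> q"
  proof (cases "x \<in> q'")
    case True then show ?thesis using q' by blast
  next
    case False
    from q'(1) obtain q'' where q'': "prime_chain R n p q''" "primeideal q' R" "q'' \<subset> q'"
      by (cases rule: prime_chain.cases) auto
    from q''(1) have "primeideal q'' R" using prime_chainD by blast
    then obtain r where r: "primeideal r R" "q'' \<subseteq> r" "r \<subset> q" "x \<in> r"
      using principal_ideal_theorem q'' q' Suc.prems(2) False by metis
    then have "q'' \<subset> r" using False q'' by blast
    then show ?thesis using prime_chain.extend[OF q''(1) r(1)] r by blast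
  qed
  then obtain r where r: "prime_chain R (Suc n) p r" "x \<in> r" "r \<subset> q" by blast
  from Suc.IH[OF r(1,2) Suc.prems(3)] show ?case
    using prime_chain.extend[OF _ q'(2) r(3)] by blast
qed

section \<open>Normality of regular local rings\<close>

text \<open>The ideal \<open>I\<close> of \<open>R/K\<close> satisfies \<open>(w/b) I \<subseteq> I\<close>, stated without fractions.\<close>

definition multiplies_into :: "('a, 'm) ring_scheme \<Rightarrow> 'a set \<Rightarrow> 'a set \<Rightarrow> 'a \<Rightarrow> 'a \<Rightarrow> bool" where
  "multiplies_into R K I w b \<longleftrightarrow>
    (\<forall>a\<in>I. \<exists>d\<in>I. w \<otimes>\<^bsub>R\<^esub> a \<ominus>\<^bsub>R\<^esub> b \<otimes>\<^bsub>R\<^esub> d \<in> K)"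

text \<open>\<open>R/K\<close> is a domain, and a fraction \<open>w/b\<close> that maps some nonzero ideal of \<open>R/K\<close> into itself belongs to
\<open>R/K\<close>. Fractions of this kind are the almost integral ones, over a Noetherian ring just the integral
ones. For \<open>b = 0\<close> in the domain \<open>R/K\<close>, the premise forces \<open>w = 0\<close>.\<close>

definition normal_modulo :: "('a, 'm) ring_scheme \<Rightarrow> 'a set \<Rightarrow> bool" where
  "normal_modulo R K \<longleftrightarrow> primeideal K R \<and>
    (\<forall>I w b. ideal I R \<longrightarrow> K \<subset> I \<longrightarrow> w \<in> carrier R \<longrightarrow> b \<in> carrier R \<longrightarrow>
      multiplies_into R K I w b \<longrightarrow> (\<exists>r\<in>carrier R. w \<ominus>\<^bsub>R\<^esub> b \<otimes>\<^bsub>R\<^esub> r \<in> K))"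

lemma normal_moduloD:
  assumes "normal_modulo R K" "ideal I R" "K \<subset> I" "w \<in> carrier R" "b \<in> carrier R"
    and "multiplies_into R K I w b"
  shows "\<exists>r\<in>carrier R. w \<ominus>\<^bsub>R\<^esub> b \<otimes>\<^bsub>R\<^esub> r \<in> K"
  using assms unfolding normal_modulo_def by simp

locale local_noetherian_cring = noetherian_cring +
  fixes m
  assumes prime_m: "primeideal m R"
    and units: "t \<in> carrier R \<Longrightarrow> t \<notin> m \<Longrightarrow> t \<in> Units R"
begin

lemma saturated_at_maximal: "ideal N R \<Longrightarrow> saturated R m N"
  unfolding saturated_def
proof (intro ballI impI)
  fix t a assume N: "ideal N R" and h: "t \<in> carrier R - m" "a \<in> carrier R" "t \<otimes> a \<in> N"
  have t: "t \<in> Units R" using units h by blast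
  have "inv t \<otimes> (t \<otimes> a) \<in> N" using ideal_memD(5)[OF N] t h by auto
  moreover have "inv t \<otimes> (t \<otimes> a) = a" using t h by (simp add: m_assoc[symmetric])
  ultimately show "a \<in> N" by simp
qed

text \<open>In a local ring every ideal is saturated at the maximal ideal, so the unit factor in Nakayama's
lemma can be dropped.\<close>

lemma nakayama_local:
  assumes N: "ideal N R" and W: "W \<subseteq> carrier R"
    and step: "\<And>w. w \<in> W \<Longrightarrow> \<exists>y\<in>m. \<exists>w'\<in>W. w \<ominus> y \<otimes> w' \<in> N"
  shows "W \<subseteq> N"
proof (rule nakayama[OF prime_m N saturated_at_maximal[OF N] W])
  fix w assume w: "w \<in> W"
  then obtain y w' where "y \<in> m" "w' \<in> W" "w \<ominus> y \<otimes> w' \<in> N" using step by blast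
  moreover have "\<one> \<otimes> w = w" using w W by auto
  moreover have "\<one> \<in> carrier R - m" using primeideal_memD(2)[OF prime_m] by simp
  ultimately show "\<exists>t\<in>carrier R - m. \<exists>y\<in>m. \<exists>w'\<in>W. t \<otimes> w \<ominus> y \<otimes> w' \<in> N" by metis
qed

text \<open>Normality of \<open>R/(x)\<close> implies that of \<open>R\<close> (everything modulo \<open>K\<close>, with \<open>K' = K + xR\<close> the ideal of
\<open>R/(x)\<close>). Let \<open>w/b\<close> map an ideal \<open>I \<noteq> 0\<close> into itself, \<open>I\<close> maximal with this property. Then \<open>I\<close> is not
contained in \<open>(x)\<close>: otherwise \<open>(I : x)\<close> has the same property, so it equals \<open>I\<close>, whence \<open>I = xI\<close> and
\<open>I = 0\<close> by Nakayama.

If \<open>x\<close> does not divide \<open>b\<close>, reduction modulo \<open>x\<close> gives \<open>w = b t + x w'\<close>, and \<open>w'/b\<close> again maps \<open>I\<close>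
into itself, because \<open>(I : x) = I\<close> here as well. So the set \<open>Wset b\<close> of admissible numerators satisfies \<open>Wset b \<subseteq> bR + x Wset b\<close>, and Nakayama
yields \<open>Wset b \<subseteq> bR\<close>. If \<open>x\<close> divides \<open>b\<close>, then it divides \<open>w\<close> too, because \<open>I\<close> is not contained in
\<open>(x)\<close>, and a common factor \<open>x\<close> can be removed from \<open>w\<close> and \<open>b\<close>. So the set of denominators \<open>b\<close> for
which \<open>Wset b \<subseteq> bR\<close> fails consists of multiples by \<open>x\<close> of its own elements, and Nakayama shows that it
is \<open>0\<close>.\<close>

lemma normal_modulo_lift:
  assumes K: "primeideal K R" and x: "x \<in> m" "x \<notin> K"
    and normal: "normal_modulo R (ideal_plus R K x)"
  shows "normal_modulo R K"
proof -
  define K' where "K' = ideal_plus R K x"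
  note Km = primeideal_memD[OF K]
  note Ki = ideal_memD[OF Km(1)]
  have xc: "x \<in> carrier R" using x primeideal_memD(3)[OF prime_m] by blast
  have K': "primeideal K' R" using normal unfolding normal_modulo_def K'_def by simp
  note K'm = primeideal_memD[OF K']
  note K'i = ideal_memD[OF K'm(1)]
  have KK': "K \<subseteq> K'" and xK': "x \<in> K'"
    unfolding K'_def using ideal_ideal_plus[OF Km(1) xc] by auto
  have K'_cases: "\<exists>k r. d = k \<oplus> x \<otimes> r \<and> k \<in> K \<and> r \<in> carrier R" if "d \<in> K'" for d
    using that unfolding K'_def ideal_plus_def by blast
  have cancel_x: "a \<in> K" if "x \<otimes> a \<in> K" "a \<in> carrier R" for a
    using Km(5)[OF xc that(2,1)] x by blast

  define good where "good w b I \<longleftrightarrow> ideal I R \<and> K \<subset> I \<and> multiplies_into R K I w b" for w b I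
  define Wset where "Wset b = {w \<in> carrier R. \<exists>I. good w b I}" for b
  have maximal_good: "\<exists>I. good w b I \<and> (\<forall>J. good w b J \<longrightarrow> I \<subseteq> J \<longrightarrow> J = I)" if w: "w \<in> Wset b" for w b
  proof -
    obtain I0 where "I0 \<in> Collect (good w b)" using w unfolding Wset_def by blast
    then obtain I where "I \<in> Collect (good w b)" "I0 \<subseteq> I" "\<And>J. J \<in> Collect (good w b) \<Longrightarrow> I \<subseteq> J \<Longrightarrow> J = I"
      by (rule maximal_ideal_in_set) (simp add: good_def, blast)
    then show ?thesis by blast
  qed
  \<comment> \<open>the maximal \<open>I\<close> contains \<open>(I : x)\<close>, provided the factors \<open>d\<close> that occur are divisible by \<open>x\<close>\<close>
  have colon_eq: "colon R I x = I"
    if g: "good w b I" and mx: "\<And>J. good w b J \<Longrightarrow> I \<subseteq> J \<Longrightarrow> J = I"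
      and w: "w \<in> carrier R" and b: "b \<in> carrier R"
      and dK: "\<And>a d. a \<in> colon R I x \<Longrightarrow> d \<in> I \<Longrightarrow> w \<otimes> (x \<otimes> a) \<ominus> b \<otimes> d \<in> K \<Longrightarrow> d \<in> K'"
    for w b I
  proof -
    have I: "ideal I R" "K \<subset> I" and mult: "multiplies_into R K I w b" using g by (auto simp: good_def)
    note Im = ideal_memD[OF I(1)]
    note col = ideal_colon[OF I(1) xc]
    have "multiplies_into R K (colon R I x) w b"
      unfolding multiplies_into_def
    proof
      fix a assume a: "a \<in> colon R I x"
      then have a': "a \<in> carrier R" "x \<otimes> a \<in> I" by (auto simp: colon_def)
      then obtain d where d: "d \<in> I" "w \<otimes> (x \<otimes> a) \<ominus> b \<otimes> d \<in> K"
        using mult unfolding multiplies_into_def by blast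
      then obtain k e where ke: "d = k \<oplus> x \<otimes> e" "k \<in> K" "e \<in> carrier R"
        using dK[OF a] K'_cases by blast
      have c: "k \<in> carrier R" "d \<in> carrier R" using ke(2) Ki(1) d(1) Im(1) by auto
      have "x \<otimes> e = (k \<oplus> x \<otimes> e) \<ominus> k" using c(1) ke(3) xc by algebra
      also have "\<dots> = d \<ominus> k" using ke by simp
      also have "\<dots> \<in> I" using Im(4)[OF d(1)] ke(2) I(2) by blast
      finally have e: "e \<in> colon R I x" using ke by (simp add: colon_def)
      have "x \<otimes> (w \<otimes> a \<ominus> b \<otimes> e) = (w \<otimes> (x \<otimes> a) \<ominus> b \<otimes> (k \<oplus> x \<otimes> e)) \<oplus> b \<otimes> k"
        using c(1) ke(3) xc a'(1) w b by algebra
      also have "\<dots> = (w \<otimes> (x \<otimes> a) \<ominus> b \<otimes> d) \<oplus> b \<otimes> k" using ke by simp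
      also have "\<dots> \<in> K" using Ki(3)[OF d(2) Ki(5)[OF b ke(2)]] .
      finally have "w \<otimes> a \<ominus> b \<otimes> e \<in> K" using cancel_x w b a' ke by simp
      then show "\<exists>d\<in>colon R I x. w \<otimes> a \<ominus> b \<otimes> d \<in> K" using e by blast
    qed
    then show ?thesis using mx[of "colon R I x"] col I(2) by (auto simp: good_def)
  qed
  have not_in_K': "\<not> I \<subseteq> K'"
    if g: "good w b I" and mx: "\<And>J. good w b J \<Longrightarrow> I \<subseteq> J \<Longrightarrow> J = I"
      and w: "w \<in> carrier R" and b: "b \<in> carrier R" for w b I
  proof
    assume sub: "I \<subseteq> K'"
    have I: "ideal I R" "K \<subset> I" using g by (auto simp: good_def)
    note Im = ideal_memD[OF I(1)]
    have col: "colon R I x = I" by (rule colon_eq[OF g mx w b]) (use sub in auto)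
    have "I \<subseteq> K"
    proof (rule nakayama_local[OF Km(1)])
      show "I \<subseteq> carrier R" using Im(1) by blast
      fix a assume a: "a \<in> I"
      then obtain k e where ke: "a = k \<oplus> x \<otimes> e" "k \<in> K" "e \<in> carrier R"
        using sub K'_cases by blast
      have kc: "k \<in> carrier R" using ke Ki by blast
      have "x \<otimes> e = (k \<oplus> x \<otimes> e) \<ominus> k" using kc ke(3) xc by algebra
      also have "\<dots> = a \<ominus> k" using ke by simp
      also have "\<dots> \<in> I" using Im(4)[OF a] ke(2) I(2) by blast
      finally have "e \<in> I" using ke col by (auto simp: colon_def)
      moreover have "a \<ominus> x \<otimes> e = k" unfolding ke(1) using kc ke(3) xc by algebra
      ultimately show "\<exists>y\<in>m. \<exists>w'\<in>I. a \<ominus> y \<otimes> w' \<in> K" using ke(2) x by blast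
    qed
    then show False using I by blast
  qed

  have case_b_notin: "Wset b \<subseteq> ideal_plus R K b" if b: "b \<in> carrier R" "b \<notin> K'" for b
  proof (rule nakayama_local)
    note Kb = ideal_ideal_plus[OF Km(1) b(1)]
    show "ideal (ideal_plus R K b) R" by (rule Kb)
    show "Wset b \<subseteq> carrier R" by (auto simp: Wset_def)
    fix w assume w: "w \<in> Wset b"
    then have wc: "w \<in> carrier R" by (simp add: Wset_def)
    obtain I where g: "good w b I" and mx: "\<And>J. good w b J \<Longrightarrow> I \<subseteq> J \<Longrightarrow> J = I"
      using maximal_good[OF w] by blast
    have I: "ideal I R" "K \<subset> I" and mult: "multiplies_into R K I w b" using g by (auto simp: good_def)
    note Im = ideal_memD[OF I(1)]
    have cancel_b: "d \<in> K'" if "b \<otimes> d \<in> K'" "d \<in> carrier R" for d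
      using K'm(5)[OF b(1) that(2,1)] b by blast
    have col: "colon R I x = I"
    proof (rule colon_eq[OF g mx wc b(1)])
      fix a d assume h: "a \<in> colon R I x" "d \<in> I" "w \<otimes> (x \<otimes> a) \<ominus> b \<otimes> d \<in> K"
      have c: "a \<in> carrier R" "d \<in> carrier R" using h(1) Im(1)[OF h(2)] by (auto simp: colon_def)
      have "b \<otimes> d = x \<otimes> (w \<otimes> a) \<ominus> (w \<otimes> (x \<otimes> a) \<ominus> b \<otimes> d)" using c wc b(1) xc by algebra
      also have "\<dots> \<in> K'" using K'i(4)[OF K'i(6)[OF _ xK', of "w \<otimes> a"]] h(3) KK' c wc by auto
      finally show "d \<in> K'" using cancel_b c by blast
    qed
    note Ix = ideal_ideal_plus[OF I(1) xc]
    have sub: "K' \<subset> ideal_plus R I x"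
    proof -
      have "K' \<subseteq> ideal_plus R I x"
        unfolding K'_def by (rule ideal_plus_least[OF Ix(1)]) (use I Ix in auto)
      then show ?thesis using not_in_K'[OF g mx wc b(1)] Ix(2) by blast
    qed
    \<comment> \<open>reduction modulo \<open>x\<close>: the image of \<open>I\<close> in \<open>R/(x)\<close> is nonzero and mapped into itself by \<open>w/b\<close>\<close>
    have "multiplies_into R K' (ideal_plus R I x) w b"
      unfolding multiplies_into_def
    proof
      fix a assume "a \<in> ideal_plus R I x"
      then obtain i r where a: "a = i \<oplus> x \<otimes> r" "i \<in> I" "r \<in> carrier R" unfolding ideal_plus_def by blast
      then obtain d where d: "d \<in> I" "w \<otimes> i \<ominus> b \<otimes> d \<in> K"
        using mult unfolding multiplies_into_def by blast
      have c: "i \<in> carrier R" "d \<in> carrier R" using a d Im(1) by auto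
      have "w \<otimes> a \<ominus> b \<otimes> d = (w \<otimes> i \<ominus> b \<otimes> d) \<oplus> x \<otimes> (w \<otimes> r)"
        unfolding a(1) using c a(3) wc xc b(1) by algebra
      also have "\<dots> \<in> K'" using K'i(3)[OF _ K'i(6)[OF _ xK', of "w \<otimes> r"]] d(2) KK' wc a(3) by auto
      finally show "\<exists>d\<in>ideal_plus R I x. w \<otimes> a \<ominus> b \<otimes> d \<in> K'" using d(1) Ix(2) by blast
    qed
    then obtain t where t: "t \<in> carrier R" "w \<ominus> b \<otimes> t \<in> K'"
      using normal Ix(1) sub wc b(1) unfolding normal_modulo_def K'_def[symmetric] by blast
    then obtain k w' where kw: "w \<ominus> b \<otimes> t = k \<oplus> x \<otimes> w'" "k \<in> K" "w' \<in> carrier R"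
      using K'_cases by blast
    have kc: "k \<in> carrier R" using kw Ki by blast
    have "multiplies_into R K I w' b"
      unfolding multiplies_into_def
    proof
      fix a assume a: "a \<in> I"
      then obtain d where d: "d \<in> I" "w \<otimes> a \<ominus> b \<otimes> d \<in> K"
        using mult unfolding multiplies_into_def by blast
      have c: "a \<in> carrier R" "d \<in> carrier R" using a d Im(1) by auto
      \<comment> \<open>\<open>x w\' a = b (d - t a)\<close> modulo \<open>K\<close>, and \<open>x\<close> divides \<open>d - t a\<close> because it does not divide \<open>b\<close>\<close>
      have eI: "d \<ominus> t \<otimes> a \<in> I" using Im(4)[OF d(1) Im(5)[OF t(1) a]] .
      have be: "b \<otimes> (d \<ominus> t \<otimes> a) = ((k \<oplus> x \<otimes> w') \<otimes> a) \<ominus> (w \<otimes> a \<ominus> b \<otimes> d)"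
        unfolding kw(1)[symmetric] using c b(1) t(1) wc by algebra
      have kx: "k \<oplus> x \<otimes> w' \<in> K'"
        using t(2) kw(1) by simp
      have "b \<otimes> (d \<ominus> t \<otimes> a) \<in> K'"
        unfolding be using K'i(4)[OF K'i(6)[OF c(1) kx]] d(2) KK' by blast
      then have "d \<ominus> t \<otimes> a \<in> K'" using cancel_b Im(1)[OF eI] by blast
      then obtain l e where le: "d \<ominus> t \<otimes> a = l \<oplus> x \<otimes> e" "l \<in> K" "e \<in> carrier R"
        using K'_cases by blast
      have lc: "l \<in> carrier R" using le Ki by blast
      have "x \<otimes> e = (l \<oplus> x \<otimes> e) \<ominus> l" using lc le(3) xc by algebra
      also have "\<dots> = (d \<ominus> t \<otimes> a) \<ominus> l" using le by simp
      also have "\<dots> \<in> I" using Im(4)[OF eI] le(2) I(2) by blast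
      finally have e: "e \<in> I" using le col by (auto simp: colon_def)
      have "x \<otimes> (w' \<otimes> a \<ominus> b \<otimes> e) = ((k \<oplus> x \<otimes> w') \<otimes> a \<ominus> b \<otimes> (l \<oplus> x \<otimes> e)) \<oplus> (b \<otimes> l \<ominus> k \<otimes> a)"
        using c lc le(3) kc kw(3) xc b(1) by algebra
      also have "\<dots> = ((k \<oplus> x \<otimes> w') \<otimes> a \<ominus> b \<otimes> (d \<ominus> t \<otimes> a)) \<oplus> (b \<otimes> l \<ominus> k \<otimes> a)"
        using le(1) by simp
      also have "\<dots> = ((k \<oplus> x \<otimes> w') \<otimes> a \<ominus> (((k \<oplus> x \<otimes> w') \<otimes> a) \<ominus> (w \<otimes> a \<ominus> b \<otimes> d))) \<oplus> (b \<otimes> l \<ominus> k \<otimes> a)"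
        unfolding be ..
      also have "\<dots> = (w \<otimes> a \<ominus> b \<otimes> d) \<oplus> (b \<otimes> l \<ominus> k \<otimes> a)"
        using c lc kc kw(3) xc b(1) wc by algebra
      also have "\<dots> \<in> K"
        using Ki(3)[OF d(2) Ki(4)[OF Ki(5)[OF b(1) le(2)] Ki(6)[OF c(1) kw(2)]]] .
      finally have "w' \<otimes> a \<ominus> b \<otimes> e \<in> K" using cancel_x kw(3) b(1) c le(3) by simp
      then show "\<exists>d\<in>I. w' \<otimes> a \<ominus> b \<otimes> d \<in> K" using e by blast
    qed
    then have "w' \<in> Wset b" using I kw(3) by (auto simp: Wset_def good_def)
    moreover have "w \<ominus> x \<otimes> w' \<in> ideal_plus R K b"
    proof -
      have "w \<ominus> x \<otimes> w' = (w \<ominus> b \<otimes> t) \<ominus> x \<otimes> w' \<oplus> b \<otimes> t" using wc kw(3) xc b(1) t(1) by algebra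
      also have "\<dots> = (k \<oplus> x \<otimes> w') \<ominus> x \<otimes> w' \<oplus> b \<otimes> t" using kw(1) by simp
      also have "\<dots> = k \<oplus> b \<otimes> t" using kc kw(3) xc b(1) t(1) by algebra
      finally show ?thesis unfolding ideal_plus_def using kw(2) t(1) by blast
    qed
    ultimately show "\<exists>y\<in>m. \<exists>w'\<in>Wset b. w \<ominus> y \<otimes> w' \<in> ideal_plus R K b" using x by blast
  qed

  have Wset_sub: "Wset b \<subseteq> ideal_plus R K b" if b: "b \<in> carrier R" "b \<notin> K" for b
  proof -
    let ?Bad = "{b \<in> carrier R. \<not> Wset b \<subseteq> ideal_plus R K b}"
    have "?Bad \<subseteq> K"
    proof (rule nakayama_local[OF Km(1)])
      fix b assume "b \<in> ?Bad"
      then have bc: "b \<in> carrier R" and nsub: "\<not> Wset b \<subseteq> ideal_plus R K b" by auto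
      have "b \<in> K'" using case_b_notin[OF bc] nsub by blast
      then obtain k c where kc: "b = k \<oplus> x \<otimes> c" "k \<in> K" "c \<in> carrier R" using K'_cases by blast
      obtain w where w: "w \<in> Wset b" "w \<notin> ideal_plus R K b" using nsub by blast
      have wc: "w \<in> carrier R" using w by (simp add: Wset_def)
      obtain I where g: "good w b I" and mx: "\<And>J. good w b J \<Longrightarrow> I \<subseteq> J \<Longrightarrow> J = I"
        using maximal_good[OF w(1)] by blast
      have I: "ideal I R" "K \<subset> I" and mult: "multiplies_into R K I w b" using g by (auto simp: good_def)
      note Im = ideal_memD[OF I(1)]
      have kcarr: "k \<in> carrier R" using kc Ki by blast
      \<comment> \<open>an element of \<open>I\<close> outside \<open>(x)\<close> transports divisibility by \<open>x\<close> from \<open>b\<close> to \<open>w\<close>\<close>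
      obtain a0 where a0: "a0 \<in> I" "a0 \<notin> K'" using not_in_K'[OF g mx wc bc] by blast
      obtain d0 where d0: "d0 \<in> I" "w \<otimes> a0 \<ominus> b \<otimes> d0 \<in> K"
        using a0 mult unfolding multiplies_into_def by blast
      have c0: "a0 \<in> carrier R" "d0 \<in> carrier R" using a0 d0 Im(1) by auto
      have "w \<otimes> a0 = (w \<otimes> a0 \<ominus> b \<otimes> d0) \<oplus> b \<otimes> d0" using c0 wc bc by algebra
      also have "\<dots> \<in> K'" using K'i(3)[OF _ K'i(6)[OF c0(2) \<open>b \<in> K'\<close>]] d0(2) KK' by blast
      finally have "w \<in> K'" using K'm(5)[OF wc c0(1)] a0 by blast
      then obtain l v where lv: "w = l \<oplus> x \<otimes> v" "l \<in> K" "v \<in> carrier R" using K'_cases by blast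
      have lc: "l \<in> carrier R" using lv Ki by blast
      have "multiplies_into R K I v c"
        unfolding multiplies_into_def
      proof
        fix a assume a: "a \<in> I"
        then obtain d where d: "d \<in> I" "w \<otimes> a \<ominus> b \<otimes> d \<in> K"
          using mult unfolding multiplies_into_def by blast
        have cc: "a \<in> carrier R" "d \<in> carrier R" using a d Im(1) by auto
        have "x \<otimes> (v \<otimes> a \<ominus> c \<otimes> d) = ((l \<oplus> x \<otimes> v) \<otimes> a \<ominus> (k \<oplus> x \<otimes> c) \<otimes> d) \<oplus> (k \<otimes> d \<ominus> l \<otimes> a)"
          using cc lc lv(3) kcarr kc(3) xc by algebra
        also have "\<dots> = (w \<otimes> a \<ominus> b \<otimes> d) \<oplus> (k \<otimes> d \<ominus> l \<otimes> a)" using kc(1) lv(1) by simp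
        also have "\<dots> \<in> K"
          using Ki(3)[OF d(2) Ki(4)[OF Ki(6)[OF cc(2) kc(2)] Ki(6)[OF cc(1) lv(2)]]] .
        finally have "v \<otimes> a \<ominus> c \<otimes> d \<in> K" using cancel_x lv(3) kc(3) cc by simp
        then show "\<exists>d\<in>I. v \<otimes> a \<ominus> c \<otimes> d \<in> K" using d by blast
      qed
      then have v: "v \<in> Wset c" using I lv(3) by (auto simp: Wset_def good_def)
      have "v \<notin> ideal_plus R K c"
      proof
        assume "v \<in> ideal_plus R K c"
        then obtain j r where jr: "v = j \<oplus> c \<otimes> r" "j \<in> K" "r \<in> carrier R" unfolding ideal_plus_def by blast
        have jc: "j \<in> carrier R" using jr Ki by blast
        have "w = (l \<oplus> x \<otimes> j \<ominus> k \<otimes> r) \<oplus> (k \<oplus> x \<otimes> c) \<otimes> r"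
          unfolding lv(1) jr(1) using lc jc jr(3) kcarr kc(3) xc by algebra
        then have "w = (l \<oplus> x \<otimes> j \<ominus> k \<otimes> r) \<oplus> b \<otimes> r" using kc(1) by simp
        moreover have "l \<oplus> x \<otimes> j \<ominus> k \<otimes> r \<in> K"
          using Ki(4)[OF Ki(3)[OF lv(2) Ki(5)[OF xc jr(2)]] Ki(6)[OF jr(3) kc(2)]] .
        ultimately show False using w(2) jr(3) unfolding ideal_plus_def by blast
      qed
      then have "c \<in> ?Bad" using v kc(3) by blast
      moreover have "b \<ominus> x \<otimes> c = k" unfolding kc(1) using kcarr kc(3) xc by algebra
      ultimately show "\<exists>y\<in>m. \<exists>w'\<in>?Bad. b \<ominus> y \<otimes> w' \<in> K" using x(1) kc(2) by metis
    qed auto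
    then show ?thesis using b by blast
  qed

  show ?thesis
    unfolding normal_modulo_def
  proof (intro conjI K allI impI)
    fix I w b assume h: "ideal I R" "K \<subset> I" "w \<in> carrier R" "b \<in> carrier R" "multiplies_into R K I w b"
    note Im = ideal_memD[OF h(1)]
    show "\<exists>r\<in>carrier R. w \<ominus> b \<otimes> r \<in> K"
    proof (cases "b \<in> K")
      case True
      obtain a where a: "a \<in> I" "a \<notin> K" using h(2) by blast
      then obtain d where d: "d \<in> I" "w \<otimes> a \<ominus> b \<otimes> d \<in> K"
        using h(5) unfolding multiplies_into_def by blast
      have c: "a \<in> carrier R" "d \<in> carrier R" using a d Im(1) by auto
      have "w \<otimes> a = (w \<otimes> a \<ominus> b \<otimes> d) \<oplus> b \<otimes> d" using c h(3,4) by algebra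
      also have "\<dots> \<in> K" using Ki(3)[OF d(2) Ki(6)[OF c(2) True]] .
      finally have "w \<in> K" using Km(5)[OF h(3) c(1)] a by blast
      moreover have "w \<ominus> b \<otimes> \<zero> = w" using h(3,4) by algebra
      ultimately show ?thesis by force
    next
      case False
      have "w \<in> Wset b" using h by (auto simp: Wset_def good_def)
      then obtain k r where kr: "w = k \<oplus> b \<otimes> r" "k \<in> K" "r \<in> carrier R"
        using Wset_sub[OF h(4) False] unfolding ideal_plus_def by blast
      have kc: "k \<in> carrier R" using kr Ki by blast
      have "w \<ominus> b \<otimes> r = k" unfolding kr(1) using kc kr(3) h(4) by algebra
      then show ?thesis using kr by blast
    qed
  qed
qed

text \<open>The induction on the number of generators of \<open>m\<close> modulo \<open>K\<close>. That \<open>K\<close> and \<open>G\<close> generate \<open>m\<close> is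
expressed by the universal property, which is stable under moving an element of \<open>G\<close> into \<open>K\<close>. The
conclusion \<open>p = K\<close>, which says that \<open>R/K\<close> is a domain, has to be proved together with normality: it
is what identifies the start of the shortened chain with \<open>K + xR\<close>.\<close>

lemma normal_modulo_of_chain:
  assumes "ideal K R" "finite G" "card G \<le> n" "G \<subseteq> m"
    and "\<And>J. ideal J R \<Longrightarrow> K \<subseteq> J \<Longrightarrow> G \<subseteq> J \<Longrightarrow> m \<subseteq> J"
    and "prime_chain R n p m" "K \<subseteq> p"
  shows "p = K \<and> normal_modulo R K"
  using assms
proof (induction n arbitrary: K G p)
  case 0
  have "p = m" using 0(6) by (cases rule: prime_chain.cases) auto
  moreover have "m \<subseteq> K" using 0 by auto
  ultimately have K: "K = m" "p = K" using 0 by auto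
  have "\<exists>r\<in>carrier R. w \<ominus> b \<otimes> r \<in> K"
    if h: "ideal I R" "K \<subset> I" "w \<in> carrier R" "b \<in> carrier R" "multiplies_into R K I w b" for I w b
  proof -
    note Im = ideal_memD[OF h(1)]
    obtain a where a: "a \<in> I" "a \<notin> m" using h(2) K by blast
    then have u: "a \<in> Units R" using units Im by blast
    have "inv a \<otimes> a \<in> I" using Im(5)[OF _ a(1)] u by blast
    then have "\<one> \<in> I" using u by simp
    then obtain d where "d \<in> I" "w \<otimes> \<one> \<ominus> b \<otimes> d \<in> K" using h(5) unfolding multiplies_into_def by blast
    then show ?thesis using h(3) Im(1) by auto
  qed
  then show ?case using K prime_m unfolding normal_modulo_def by blast
next
  case (Suc n)
  have pp: "primeideal p R" "p \<noteq> m" "p \<subseteq> m" using prime_chainD[OF Suc.prems(6)] by auto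
  note pm = primeideal_memD[OF pp(1)]
  note pi = ideal_memD[OF pm(1)]
  have "\<not> G \<subseteq> p" using Suc.prems(5)[OF pm(1) Suc.prems(7)] pp by blast
  then obtain x where x: "x \<in> G" "x \<notin> p" by blast
  have xm: "x \<in> m" using x Suc.prems(4) by blast
  have xc: "x \<in> carrier R" using xm primeideal_memD(3)[OF prime_m] by blast
  obtain p' where p': "prime_chain R n p' m" "x \<in> p'" "p \<subseteq> p'"
    using prime_chain_through[OF Suc.prems(6) xm x(2)] by blast
  have p'i: "ideal p' R" using primeideal_memD(1) prime_chainD[OF p'(1)] by blast
  note Kx = ideal_ideal_plus[OF Suc.prems(1) xc]
  have "p' = ideal_plus R K x \<and> normal_modulo R (ideal_plus R K x)"
  proof (rule Suc.IH[OF Kx(1) _ _ _ _ p'(1)])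
    show "finite (G - {x})" "G - {x} \<subseteq> m" using Suc.prems by auto
    show "card (G - {x}) \<le> n" using Suc.prems(2,3) x by simp
    show "ideal_plus R K x \<subseteq> p'"
      by (rule ideal_plus_least[OF p'i]) (use Suc.prems(7) p' in auto)
    show "m \<subseteq> J" if "ideal J R" "ideal_plus R K x \<subseteq> J" "G - {x} \<subseteq> J" for J
      by (rule Suc.prems(5)[OF that(1)]) (use that Kx in auto)
  qed
  then have eq: "p' = ideal_plus R K x" and nrm: "normal_modulo R (ideal_plus R K x)" by auto
  have "p \<subseteq> K"
  proof (rule nakayama_local[OF Suc.prems(1) pm(3)])
    fix a assume a: "a \<in> p"
    then have "a \<in> ideal_plus R K x" using p'(3) eq by blast
    then obtain k r where kr: "a = k \<oplus> x \<otimes> r" "k \<in> K" "r \<in> carrier R" unfolding ideal_plus_def by blast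
    have kp: "k \<in> p" using kr Suc.prems(7) by blast
    have kc: "k \<in> carrier R" using kp pm by blast
    have "x \<otimes> r = (k \<oplus> x \<otimes> r) \<ominus> k" using kc kr(3) xc by algebra
    also have "\<dots> = a \<ominus> k" using kr by simp
    also have "\<dots> \<in> p" using pi(4)[OF a kp] .
    finally have "r \<in> p" using pm(5)[OF xc kr(3)] x by blast
    moreover have "a \<ominus> x \<otimes> r = k" unfolding kr(1) using kc kr(3) xc by algebra
    ultimately show "\<exists>y\<in>m. \<exists>w'\<in>p. a \<ominus> y \<otimes> w' \<in> K" using xm kr(2) by metis
  qed
  \<comment> \<open>\<open>p \<subseteq> K + xR\<close> and \<open>x \<notin> p\<close> gave \<open>p \<subseteq> K + x p\<close>, so Nakayama applied\<close>
  then have "p = K" using Suc.prems(7) by blast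
  then show ?case using normal_modulo_lift[of K x] pp(1) xm x(2) nrm by blast
qed

end

context noetherian_cring
begin

lemma exists_maximalideal:
  assumes "ideal I R" "I \<noteq> carrier R"
  obtains M where "maximalideal M R" "I \<subseteq> M"
proof -
  have "I \<in> {J. ideal J R \<and> J \<noteq> carrier R}" using assms by simp
  then obtain M where M: "M \<in> {J. ideal J R \<and> J \<noteq> carrier R}" "I \<subseteq> M"
    and max: "\<And>J. J \<in> {J. ideal J R \<and> J \<noteq> carrier R} \<Longrightarrow> M \<subseteq> J \<Longrightarrow> J = M"
    by (rule maximal_ideal_in_set) (simp, blast)
  have "maximalideal M R"
    using M max by (intro maximalidealI) auto
  then show thesis using that M(2) by blast
qed

lemma Units_of_unique_maximalideal:
  assumes M: "{I. maximalideal I R} = {M}" and t: "t \<in> carrier R" "t \<notin> M"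
  shows "t \<in> Units R"
proof -
  have "PIdl t = carrier R"
  proof (rule ccontr)
    assume "PIdl t \<noteq> carrier R"
    then obtain M' where "maximalideal M' R" "PIdl t \<subseteq> M'"
      using exists_maximalideal[OF cgenideal_ideal[OF t(1)]] by blast
    then show False using M t cgenideal_self[OF t(1)] by blast
  qed
  then obtain y where "y \<in> carrier R" "\<one> = y \<otimes> t" by (auto simp: cgenideal_def)
  then show ?thesis using t by (metis m_comm unit_factor Units_one_closed)
qed

end

text \<open>A finite dimension is attained, since a nonempty set of extended naturals with finite supremum is
finite.\<close>

lemma prime_chain_krull_dim:
  assumes "krull_dim R = enat n" "primeideal P R"
  obtains p :: "nat \<Rightarrow> 'a set" where "\<And>i. i \<le> n \<Longrightarrow> primeideal (p i) R" "\<And>i. i < n \<Longrightarrow> p i \<subset> p (Suc i)"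
proof -
  define lengths where "lengths = {enat n | n. \<exists>p :: nat \<Rightarrow> 'a set.
    (\<forall>i\<le>n. primeideal (p i) R) \<and> (\<forall>i<n. p i \<subset> p (Suc i))}"
  have "enat 0 \<in> lengths"
    unfolding lengths_def using assms(2) by (intro CollectI exI[of _ 0] conjI exI[of _ "\<lambda>_. P"]) auto
  then have ne: "lengths \<noteq> {}" by blast
  have sup: "Sup lengths = enat n" using assms(1) by (simp add: krull_dim_def lengths_def)
  then have fin: "finite lengths" using ne by (auto simp: Sup_enat_def split: if_splits)
  then have "Sup lengths = Max lengths" using ne by (simp add: Sup_enat_def)
  then have "enat n \<in> lengths" using Max_in[OF fin ne] sup by simp
  then show thesis using that unfolding lengths_def by auto
qed

theorem regular_local_ring_normal:
  fixes R (structure)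
  assumes "regular_local_ring R"
  shows "normal_modulo R {\<zero>}"
proof -
  obtain M G where "cring R" "noetherian_ring R" and M: "{I. maximalideal I R} = {M}"
    and G: "G \<subseteq> carrier R" "finite G" "M = genideal R G" "enat (card G) = krull_dim R"
    using assms unfolding regular_local_ring_def by blast
  interpret noetherian_cring R using \<open>cring R\<close> \<open>noetherian_ring R\<close> by (simp add: noetherian_cring_def)
  have "maximalideal M R" using M by blast
  then have primeM: "primeideal M R" by (rule maximalideal_prime)
  interpret local_noetherian_cring R M
  proof (rule local_noetherian_cring.intro[OF noetherian_cring_axioms])
    show "local_noetherian_cring_axioms R M"
    proof (rule local_noetherian_cring_axioms.intro)
      show "primeideal M R" by (rule primeM)
      show "t \<in> Units R" if "t \<in> carrier R" "t \<notin> M" for t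
        by (rule Units_of_unique_maximalideal[OF M that])
    qed
  qed
  define n where "n = card G"
  obtain p where p: "\<And>i. i \<le> n \<Longrightarrow> primeideal (p i) R" "\<And>i. i < n \<Longrightarrow> p i \<subset> p (Suc i)"
    using prime_chain_krull_dim[OF _ primeM, of n] G(4) unfolding n_def by metis
  have in_M: "q \<subseteq> M" if "primeideal q R" for q
  proof
    note q = primeideal_memD[OF that]
    fix t assume t: "t \<in> q"
    show "t \<in> M"
    proof (rule ccontr)
      assume "t \<notin> M"
      then have u: "t \<in> Units R" using units t q(3) by blast
      then have "inv t \<otimes> t \<in> q" using ideal_memD(5)[OF q(1)] t by blast
      then show False using q(2) u by simp
    qed
  qed
  \<comment> \<open>a chain of maximal length can be made to end at \<open>M\<close>, which contains every prime\<close>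
  define g where "g = p(n := M)"
  have g: "primeideal (g i) R" if "i \<le> n" for i using that p primeM by (auto simp: g_def)
  have g_less: "g i \<subset> g (Suc i)" if "i < n" for i
    using p(2)[OF that] in_M[OF p(1)[of n]] that by (cases "Suc i = n") (auto simp: g_def)
  have "prime_chain R k (g 0) (g k)" if "k \<le> n" for k
    using that
  proof (induction k)
    case 0 then show ?case using g prime_chain.start by blast
  next
    case (Suc k) then show ?case using g[of "Suc k"] g_less[of k] prime_chain.extend by fastforce
  qed
  then have chain: "prime_chain R n (g 0) M" by (force simp: g_def)
  have "g 0 = {\<zero>} \<and> normal_modulo R {\<zero>}"
  proof (rule normal_modulo_of_chain[OF zeroideal G(2) _ _ _ chain])
    show "card G \<le> n" by (simp add: n_def)
    show "G \<subseteq> M" using genideal_self[OF G(1)] G(3) by simp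
    show "M \<subseteq> J" if "ideal J R" "G \<subseteq> J" for J using genideal_minimal[OF that] G(3) by simp
    show "{\<zero>} \<subseteq> g 0" using ideal_memD(2)[OF primeideal_memD(1)[OF g[of 0]]] by simp
  qed
  then show ?thesis by simp
qed

section \<open>Integral elements and common denominators\<close>

lemma (in ring) eval_Cons: "eval (a # p) x = a \<otimes> x [^] length p \<oplus> eval p x"
  by simp

context cring
begin

text \<open>If \<open>c\<close> clears the denominators of the powers of \<open>x\<close> that occur in \<open>x\<^sup>k p(x)\<close>, it clears that of
\<open>x\<^sup>k p(x)\<close>.\<close>

lemma eval_mult_power_in:
  assumes K: "subring K R" and x: "x \<in> carrier R" and c: "c \<in> carrier R"
    and p: "set p \<subseteq> K" and bound: "\<And>i. i < length p \<Longrightarrow> c \<otimes> x [^] (i + k) \<in> K"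
  shows "c \<otimes> x [^] k \<otimes> eval p x \<in> K"
  using p bound
proof (induction p)
  case Nil then show ?case using subringE(2)[OF K] x c by simp
next
  case (Cons a p)
  have K_carr: "K \<subseteq> carrier R" using subringE(1)[OF K] .
  have e: "eval p x \<in> carrier R" using Cons.prems K_carr x by (intro eval_in_carrier) auto
  have a: "a \<in> K" "a \<in> carrier R" using Cons.prems K_carr by auto
  have "c \<otimes> x [^] k \<otimes> eval (a # p) x = a \<otimes> (c \<otimes> (x [^] length p \<otimes> x [^] k)) \<oplus> c \<otimes> x [^] k \<otimes> eval p x"
    unfolding eval_Cons using e a c x by (simp add: r_distr m_ac)
  also have "x [^] length p \<otimes> x [^] k = x [^] (length p + k)" using x by (simp add: nat_pow_mult)
  also have "a \<otimes> (c \<otimes> x [^] (length p + k)) \<oplus> c \<otimes> x [^] k \<otimes> eval p x \<in> K"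
    using subringE(6,7)[OF K] Cons a by auto
  finally show ?case .
qed

text \<open>If \<open>x\<close> satisfies a monic equation of degree \<open>m\<close>, then \<open>b\<^sup>m\<close> clears the denominators of \<open>x\<^sup>j\<close> for
\<open>j \<le> m\<close>, and the equation reduces the higher powers to these.\<close>

lemma integral_imp_bounded_powers:
  assumes K: "subring K R" and x: "x \<in> carrier R" and int: "integral_over R K x"
    and b: "b \<in> K" "b \<otimes> x \<in> K"
  shows "\<exists>m::nat. \<forall>j::nat. b [^] m \<otimes> x [^] j \<in> K"
proof -
  obtain q where q: "q \<noteq> []" "set q \<subseteq> K" "lead_coeff q = \<one>" "eval q x = \<zero>"
    using int unfolding integral_over_def by blast
  then obtain p where qp: "q = \<one> # p" by (cases q) auto
  define m where "m = length p"
  have K_carr: "K \<subseteq> carrier R" using subringE(1)[OF K] .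
  have bc: "b \<in> carrier R" using b K_carr by blast
  have pc: "eval p x \<in> carrier R" using q qp K_carr x by (intro eval_in_carrier) auto
  have "x [^] m \<oplus> eval p x = \<zero>" using q(4) x unfolding qp eval_Cons m_def by simp
  then have xm: "x [^] m = \<ominus> eval p x" using x pc by (simp add: minus_equality)
  have powK: "y [^] (i::nat) \<in> K" if "y \<in> K" for y i
    using that subringE(3,6)[OF K] by (induction i) auto
  have small: "b [^] m \<otimes> x [^] j \<in> K" if "j \<le> m" for j
  proof -
    have "b [^] m = b [^] (m - j) \<otimes> b [^] j" using that bc by (simp add: nat_pow_mult)
    then have "b [^] m \<otimes> x [^] j = b [^] (m - j) \<otimes> (b \<otimes> x) [^] j"
      using bc x by (simp add: m_assoc nat_pow_distrib)
    then show ?thesis using powK[OF b(1)] powK[OF b(2)] subringE(6)[OF K] by simp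
  qed
  have "b [^] m \<otimes> x [^] j \<in> K" for j :: nat
  proof (induction j rule: less_induct)
    case (less j)
    show ?case
    proof (cases "j \<le> m")
      case True then show ?thesis by (rule small)
    next
      case False
      define k where "k = j - m"
      have j: "j = k + m" "0 < k" using False by (auto simp: k_def)
      have "b [^] m \<otimes> x [^] j = \<ominus> (b [^] m \<otimes> x [^] k \<otimes> eval p x)"
        using bc x pc unfolding j(1) by (simp add: nat_pow_mult[symmetric] xm m_assoc r_minus)
      also have "\<dots> \<in> K"
        using eval_mult_power_in[OF K x, of "b [^] m" p k] bc q(2) qp less j
        by (intro subringE(5)[OF K]) (auto simp: m_def)
      finally show ?thesis .
    qed
  qed
  then show ?thesis by blast
qed

lemma eval_add_same_length:
  assumes K: "subring K R" and x: "x \<in> carrier R"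
    and "length p = length q" "set p \<subseteq> K" "set q \<subseteq> K"
  shows "\<exists>r. length r = length p \<and> set r \<subseteq> K \<and> eval r x = eval p x \<oplus> eval q x"
  using assms(3-)
proof (induction p q rule: list_induct2)
  case Nil then show ?case by simp
next
  case (Cons a p b q)
  then obtain r where r: "length r = length p" "set r \<subseteq> K" "eval r x = eval p x \<oplus> eval q x" by auto
  have K_carr: "K \<subseteq> carrier R" using subringE(1)[OF K] .
  have c: "eval p x \<in> carrier R" "eval q x \<in> carrier R" "a \<in> carrier R" "b \<in> carrier R"
    using Cons.prems K_carr x by (auto intro!: eval_in_carrier)
  have "eval ((a \<oplus> b) # r) x = eval (a # p) x \<oplus> eval (b # q) x"
    unfolding eval_Cons r(1,3) Cons.hyps[symmetric] using c nat_pow_closed[OF x, of "length p"] by algebra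
  then show ?case using r subringE(7)[OF K] Cons.prems by (intro exI[of _ "(a \<oplus> b) # r"]) auto
qed

lemma eval_map_mult:
  assumes "k \<in> carrier R" "x \<in> carrier R" "set p \<subseteq> carrier R"
  shows "eval (map ((\<otimes>) k) p) x = k \<otimes> eval p x"
  using assms(3)
proof (induction p)
  case (Cons a p)
  then show ?case using assms eval_in_carrier[of p x] by (simp add: r_distr m_assoc del: eval.simps add: eval_Cons)
qed (use assms in simp)

end

lemma eval_hom:
  assumes "ring R" "ring T" and h: "h \<in> ring_hom R T" and "set p \<subseteq> carrier R" "x \<in> carrier R"
  shows "ring.eval T (map h p) (h x) = h (ring.eval R p x)"
proof -
  interpret R: ring R by fact
  interpret T: ring T by fact
  interpret ring_hom_ring R T h using assms by (simp add: ring_hom_ring_def ring_hom_ring_axioms_def)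
  show ?thesis using assms(4)
  proof (induction p)
    case (Cons a p)
    then show ?case using assms(5) R.eval_in_carrier[of p x]
      by (simp del: R.eval.simps T.eval.simps add: R.eval_Cons T.eval_Cons hom_nat_pow)
  qed simp
qed

lemma integral_over_hom:
  assumes "ring R" "ring T" and h: "h \<in> ring_hom R T" and "K \<subseteq> carrier R" "h ` K \<subseteq> K'"
    and x: "x \<in> carrier R" and "integral_over R K x"
  shows "integral_over T K' (h x)"
proof -
  obtain p where p: "p \<noteq> []" "set p \<subseteq> K" "lead_coeff p = \<one>\<^bsub>R\<^esub>" "ring.eval R p x = \<zero>\<^bsub>R\<^esub>"
    using assms(7) unfolding integral_over_def by blast
  have "ring.eval T (map h p) (h x) = \<zero>\<^bsub>T\<^esub>"
    using eval_hom[OF assms(1-3) _ x, of p] p assms(4) ring_hom_zero[OF h assms(1,2)] by auto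
  moreover have "lead_coeff (map h p) = \<one>\<^bsub>T\<^esub>" using p ring_hom_one[OF h] by (simp add: hd_map)
  ultimately show ?thesis unfolding integral_over_def
    using p assms(5) by (intro exI[of _ "map h p"]) auto
qed

text \<open>The properties that characterize the total ring of fractions \<open>Q\<close> of \<open>R\<close>, with structure map \<open>j\<close>.\<close>

locale fraction_ring = cring R + Q: cring Q for R (structure) and Q :: "('b, 'n) ring_scheme" +
  fixes j :: "'a \<Rightarrow> 'b"
  assumes j_hom: "j \<in> ring_hom R Q"
    and j_inj: "inj_on j (carrier R)"
    and j_Units: "b \<in> nonzerodivisors R \<Longrightarrow> j b \<in> Units Q"
    and denominator: "x \<in> carrier Q \<Longrightarrow>
      \<exists>a\<in>carrier R. \<exists>b\<in>nonzerodivisors R. j b \<otimes>\<^bsub>Q\<^esub> x = j a"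
begin

abbreviation (input) K where "K \<equiv> j ` carrier R"

lemma j_closed [simp]: "a \<in> carrier R \<Longrightarrow> j a \<in> carrier Q"
  by (rule ring_hom_closed[OF j_hom])

lemma j_simps [simp]:
  "a \<in> carrier R \<Longrightarrow> b \<in> carrier R \<Longrightarrow> j (a \<otimes> b) = j a \<otimes>\<^bsub>Q\<^esub> j b"
  "a \<in> carrier R \<Longrightarrow> b \<in> carrier R \<Longrightarrow> j (a \<oplus> b) = j a \<oplus>\<^bsub>Q\<^esub> j b"
  "j \<one> = \<one>\<^bsub>Q\<^esub>" "j \<zero> = \<zero>\<^bsub>Q\<^esub>"
  using ring_hom_mult[OF j_hom] ring_hom_add[OF j_hom] ring_hom_one[OF j_hom]
    ring_hom_zero[OF j_hom ring_axioms Q.ring_axioms] by auto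

lemma j_eqD: "j a = j b \<Longrightarrow> a \<in> carrier R \<Longrightarrow> b \<in> carrier R \<Longrightarrow> a = b"
  using j_inj by (auto dest: inj_onD)

lemma subring_K: "subring K Q"
proof -
  interpret ring_hom_ring R Q j
    by (simp add: ring_hom_ring_def ring_hom_ring_axioms_def j_hom ring_axioms Q.ring_axioms)
  show ?thesis using img_is_subring[OF carrier_is_subring] .
qed

lemma nonzerodivisorsD: "b \<in> nonzerodivisors R \<Longrightarrow> b \<in> carrier R"
  by (simp add: nonzerodivisors_def)

lemma nonzerodivisors_mult: "b \<in> nonzerodivisors R \<Longrightarrow> c \<in> nonzerodivisors R \<Longrightarrow> b \<otimes> c \<in> nonzerodivisors R"
  using submonoid.m_closed[OF mult_set.axioms(2)[OF mult_set_nonzerodivisors[OF is_cring]]] .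

definition common_denominator :: "'b \<Rightarrow> 'a \<Rightarrow> bool" where
  "common_denominator x c \<longleftrightarrow> c \<in> carrier R \<and> (\<forall>k::nat. j c \<otimes>\<^bsub>Q\<^esub> x [^]\<^bsub>Q\<^esub> k \<in> K)"

lemma integral_imp_common_denominator:
  assumes x: "x \<in> carrier Q" and int: "integral_over Q K x"
  shows "\<exists>c\<in>nonzerodivisors R. common_denominator x c"
proof -
  obtain a b where ab: "a \<in> carrier R" "b \<in> nonzerodivisors R" "j b \<otimes>\<^bsub>Q\<^esub> x = j a"
    using denominator[OF x] by blast
  have bc: "b \<in> carrier R" using nonzerodivisorsD ab by blast
  obtain m :: nat where m: "\<And>k::nat. j b [^]\<^bsub>Q\<^esub> m \<otimes>\<^bsub>Q\<^esub> x [^]\<^bsub>Q\<^esub> k \<in> K"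
    using Q.integral_imp_bounded_powers[OF subring_K x int, of "j b"] ab bc by auto
  have "b [^] i \<in> nonzerodivisors R" for i :: nat
  proof (induction i)
    case 0 then show ?case by (auto simp: nonzerodivisors_def)
  next
    case (Suc i) then show ?case using nonzerodivisors_mult ab by simp
  qed
  moreover have "j (b [^] i) = j b [^]\<^bsub>Q\<^esub> i" for i :: nat
    using bc by (induction i) auto
  ultimately show ?thesis
    using m bc unfolding common_denominator_def by (intro bexI[of _ "b [^] m"]) auto
qed

text \<open>The converse for Noetherian \<open>R\<close>. The numerators, with respect to the denominator \<open>c\<close>, of the
elements of \<open>R + Rx + \<dots> + Rx\<^sup>n\<^sup>-\<^sup>1\<close> form an ascending chain of ideals \<open>L n\<close>. Once \<open>L (n + 1) = L n\<close>,
the power \<open>x\<^sup>n\<close> is a combination of lower ones.\<close>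

lemma common_denominator_imp_integral:
  assumes noeth: "noetherian_ring R" and x: "x \<in> carrier Q"
    and c: "c \<in> nonzerodivisors R" "common_denominator x c"
  shows "integral_over Q K x"
proof -
  interpret noetherian_cring R using noeth is_cring by (simp add: noetherian_cring_def)
  have cc: "c \<in> carrier R" using c nonzerodivisorsD by blast
  have K_carr: "K \<subseteq> carrier Q" by auto
  define L where "L n = {r \<in> carrier R. \<exists>p. length p = n \<and> set p \<subseteq> K \<and> j r = j c \<otimes>\<^bsub>Q\<^esub> Q.eval p x}" for n
  have L_ideal: "ideal (L n) R" for n
  proof (rule ideal_intro)
    show "L n \<subseteq> carrier R" by (auto simp: L_def)
    have "Q.eval (replicate n \<zero>\<^bsub>Q\<^esub>) x = \<zero>\<^bsub>Q\<^esub>"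
      using Q.eval_replicate[of "[]" x n] x by simp
    then have "j \<zero> = j c \<otimes>\<^bsub>Q\<^esub> Q.eval (replicate n \<zero>\<^bsub>Q\<^esub>) x" using cc by simp
    moreover have "set (replicate n \<zero>\<^bsub>Q\<^esub>) \<subseteq> K"
      using subringE(2)[OF subring_K] by (metis in_set_replicate subsetI)
    ultimately show "\<zero> \<in> L n"
      unfolding L_def by (intro CollectI conjI zero_closed exI[of _ "replicate n \<zero>\<^bsub>Q\<^esub>"]) simp_all
  next
    fix r t assume "r \<in> L n" "t \<in> L n"
    then obtain p q where h: "r \<in> carrier R" "t \<in> carrier R"
      "length p = n" "set p \<subseteq> K" "j r = j c \<otimes>\<^bsub>Q\<^esub> Q.eval p x"
      "length q = n" "set q \<subseteq> K" "j t = j c \<otimes>\<^bsub>Q\<^esub> Q.eval q x" unfolding L_def by blast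
    then obtain p' where p': "length p' = n" "set p' \<subseteq> K" "Q.eval p' x = Q.eval p x \<oplus>\<^bsub>Q\<^esub> Q.eval q x"
      using Q.eval_add_same_length[OF subring_K x, of p q] by auto
    have "Q.eval p x \<in> carrier Q" "Q.eval q x \<in> carrier Q"
      using h K_carr x by (auto intro!: Q.eval_in_carrier)
    then have "j (r \<oplus> t) = j c \<otimes>\<^bsub>Q\<^esub> Q.eval p' x" using h p' cc by (simp add: Q.r_distr)
    then show "r \<oplus> t \<in> L n" unfolding L_def using h p' by blast
  next
    fix k r assume k: "k \<in> carrier R" and "r \<in> L n"
    then obtain p where h: "r \<in> carrier R" "length p = n" "set p \<subseteq> K" "j r = j c \<otimes>\<^bsub>Q\<^esub> Q.eval p x"
      unfolding L_def by blast
    have pc: "set p \<subseteq> carrier Q" using h K_carr by blast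
    have "Q.eval p x \<in> carrier Q" using pc x by (rule Q.eval_in_carrier)
    then have "j (k \<otimes> r) = j c \<otimes>\<^bsub>Q\<^esub> Q.eval (map ((\<otimes>\<^bsub>Q\<^esub>) (j k)) p) x"
      using Q.eval_map_mult[OF _ x pc, of "j k"] h k cc by (simp add: Q.m_lcomm)
    moreover have "set (map ((\<otimes>\<^bsub>Q\<^esub>) (j k)) p) \<subseteq> K" using subringE(6)[OF subring_K] h k by auto
    ultimately show "k \<otimes> r \<in> L n" unfolding L_def using h k
      by (auto intro!: exI[of _ "map ((\<otimes>\<^bsub>Q\<^esub>) (j k)) p"])
  qed
  have L_mono: "L n \<subseteq> L (Suc n)" for n
  proof
    fix r assume "r \<in> L n"
    then obtain p where h: "r \<in> carrier R" "length p = n" "set p \<subseteq> K" "j r = j c \<otimes>\<^bsub>Q\<^esub> Q.eval p x"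
      unfolding L_def by blast
    have "Q.eval p x \<in> carrier Q" using h K_carr x by (auto intro!: Q.eval_in_carrier)
    then have "Q.eval (\<zero>\<^bsub>Q\<^esub> # p) x = Q.eval p x" using x by (simp add: Q.eval_Cons del: Q.eval.simps)
    then show "r \<in> L (Suc n)" unfolding L_def using h subringE(2)[OF subring_K]
      by (auto simp del: Q.eval.simps intro!: exI[of _ "\<zero>\<^bsub>Q\<^esub> # p"])
  qed
  have "L 0 \<in> range L" by simp
  then obtain I where I: "I \<in> range L" "L 0 \<subseteq> I" "\<And>J. J \<in> range L \<Longrightarrow> I \<subseteq> J \<Longrightarrow> J = I"
    by (rule maximal_ideal_in_set) (use L_ideal in \<open>auto\<close>)
  then obtain n where "I = L n" by blast
  then have stable: "L (Suc n) = L n" using I(3)[of "L (Suc n)"] L_mono by blast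
  obtain r where r: "r \<in> carrier R" "j c \<otimes>\<^bsub>Q\<^esub> x [^]\<^bsub>Q\<^esub> n = j r"
    using c(2) unfolding common_denominator_def by blast
  have "Q.eval (\<one>\<^bsub>Q\<^esub> # replicate n \<zero>\<^bsub>Q\<^esub>) x = x [^]\<^bsub>Q\<^esub> n"
    using Q.eval_replicate[of "[]" x n] x by (simp add: Q.eval_Cons del: Q.eval.simps(2))
  then have "r \<in> L (Suc n)" unfolding L_def using r subringE(2,3)[OF subring_K]
    by (auto simp del: Q.eval.simps intro!: exI[of _ "\<one>\<^bsub>Q\<^esub> # replicate n \<zero>\<^bsub>Q\<^esub>"])
  then obtain p where p: "length p = n" "set p \<subseteq> K" "j r = j c \<otimes>\<^bsub>Q\<^esub> Q.eval p x"
    using stable unfolding L_def by blast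
  have pc: "set p \<subseteq> carrier Q" using p K_carr by blast
  have ec: "Q.eval p x \<in> carrier Q" using pc x by (rule Q.eval_in_carrier)
  have xn: "x [^]\<^bsub>Q\<^esub> n = Q.eval p x"
    using r(2) p(3) Q.Units_l_cancel[OF j_Units[OF c(1)] _ ec, of "x [^]\<^bsub>Q\<^esub> n"] x by simp
  define q where "q = map ((\<otimes>\<^bsub>Q\<^esub>) (\<ominus>\<^bsub>Q\<^esub> \<one>\<^bsub>Q\<^esub>)) p"
  have "Q.eval q x = \<ominus>\<^bsub>Q\<^esub> Q.eval p x"
    unfolding q_def using Q.eval_map_mult[OF _ x pc, of "\<ominus>\<^bsub>Q\<^esub> \<one>\<^bsub>Q\<^esub>"] ec by (simp add: Q.l_minus)
  then have "Q.eval (\<one>\<^bsub>Q\<^esub> # q) x = \<zero>\<^bsub>Q\<^esub>"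
    using xn x ec p(1) by (simp add: Q.eval_Cons q_def Q.r_neg del: Q.eval.simps)
  moreover have "set q \<subseteq> K"
    unfolding q_def using subringE(3,5,6)[OF subring_K] p(2) by auto
  ultimately show ?thesis
    unfolding integral_over_def using subringE(3)[OF subring_K]
    by (intro exI[of _ "\<one>\<^bsub>Q\<^esub> # q"]) auto
qed

text \<open>If \<open>c\<close> and \<open>d\<close> are common denominators of the powers of \<open>x\<close> and \<open>y\<close>, then \<open>c d\<close> is one for all
monomials \<open>x\<^sup>k y\<^sup>l\<close>. The set \<open>D\<close> of all \<open>z \<in> Q\<close> that multiply these monomials into \<open>R\<close> is stable under multiplication by \<open>x + y\<close>, which avoids expanding the powers of \<open>x + y\<close>.\<close>

lemma integral_add:
  assumes noeth: "noetherian_ring R"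
    and x: "x \<in> carrier Q" "integral_over Q K x" and y: "y \<in> carrier Q" "integral_over Q K y"
  shows "integral_over Q K (x \<oplus>\<^bsub>Q\<^esub> y)"
proof -
  obtain c d where c: "c \<in> nonzerodivisors R" "common_denominator x c"
    and d: "d \<in> nonzerodivisors R" "common_denominator y d"
    using integral_imp_common_denominator x y by meson
  have cd: "c \<in> carrier R" "d \<in> carrier R" using c d nonzerodivisorsD by auto
  define D where "D = {z \<in> carrier Q. \<forall>(k::nat) (l::nat). z \<otimes>\<^bsub>Q\<^esub> (x [^]\<^bsub>Q\<^esub> k \<otimes>\<^bsub>Q\<^esub> y [^]\<^bsub>Q\<^esub> l) \<in> K}"
  have "j (c \<otimes> d) \<in> D"
  proof -
    have "j (c \<otimes> d) \<otimes>\<^bsub>Q\<^esub> (x [^]\<^bsub>Q\<^esub> k \<otimes>\<^bsub>Q\<^esub> y [^]\<^bsub>Q\<^esub> l) \<in> K" for k l :: nat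
    proof -
      have "j (c \<otimes> d) \<otimes>\<^bsub>Q\<^esub> (x [^]\<^bsub>Q\<^esub> k \<otimes>\<^bsub>Q\<^esub> y [^]\<^bsub>Q\<^esub> l)
        = (j c \<otimes>\<^bsub>Q\<^esub> x [^]\<^bsub>Q\<^esub> k) \<otimes>\<^bsub>Q\<^esub> (j d \<otimes>\<^bsub>Q\<^esub> y [^]\<^bsub>Q\<^esub> l)"
        using cd x y by (simp add: Q.m_ac)
      then show ?thesis using c(2) d(2) subringE(6)[OF subring_K] unfolding common_denominator_def by simp
    qed
    then show ?thesis unfolding D_def using cd by simp
  qed
  have step: "z \<otimes>\<^bsub>Q\<^esub> (x \<oplus>\<^bsub>Q\<^esub> y) \<in> D" if z: "z \<in> D" for z
  proof -
    have zc: "z \<in> carrier Q" and zK: "\<And>(k::nat) (l::nat). z \<otimes>\<^bsub>Q\<^esub> (x [^]\<^bsub>Q\<^esub> k \<otimes>\<^bsub>Q\<^esub> y [^]\<^bsub>Q\<^esub> l) \<in> K"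
      using z by (auto simp: D_def)
    have eq: "z \<otimes>\<^bsub>Q\<^esub> (x \<oplus>\<^bsub>Q\<^esub> y) \<otimes>\<^bsub>Q\<^esub> (x [^]\<^bsub>Q\<^esub> k \<otimes>\<^bsub>Q\<^esub> y [^]\<^bsub>Q\<^esub> l)
        = z \<otimes>\<^bsub>Q\<^esub> (x [^]\<^bsub>Q\<^esub> Suc k \<otimes>\<^bsub>Q\<^esub> y [^]\<^bsub>Q\<^esub> l) \<oplus>\<^bsub>Q\<^esub> z \<otimes>\<^bsub>Q\<^esub> (x [^]\<^bsub>Q\<^esub> k \<otimes>\<^bsub>Q\<^esub> y [^]\<^bsub>Q\<^esub> Suc l)" for k l :: nat
      using zc x y by (simp add: Q.r_distr Q.l_distr Q.m_ac)
    have "z \<otimes>\<^bsub>Q\<^esub> (x \<oplus>\<^bsub>Q\<^esub> y) \<otimes>\<^bsub>Q\<^esub> (x [^]\<^bsub>Q\<^esub> k \<otimes>\<^bsub>Q\<^esub> y [^]\<^bsub>Q\<^esub> l) \<in> K" for k l :: nat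
      unfolding eq by (rule subringE(7)[OF subring_K zK zK])
    then show ?thesis using zc x y unfolding D_def by blast
  qed
  have "j (c \<otimes> d) \<otimes>\<^bsub>Q\<^esub> (x \<oplus>\<^bsub>Q\<^esub> y) [^]\<^bsub>Q\<^esub> k \<in> D" for k :: nat
  proof (induction k)
    case 0 then show ?case using \<open>j (c \<otimes> d) \<in> D\<close> cd by simp
  next
    case (Suc k)
    have "j (c \<otimes> d) \<otimes>\<^bsub>Q\<^esub> (x \<oplus>\<^bsub>Q\<^esub> y) [^]\<^bsub>Q\<^esub> Suc k
      = j (c \<otimes> d) \<otimes>\<^bsub>Q\<^esub> (x \<oplus>\<^bsub>Q\<^esub> y) [^]\<^bsub>Q\<^esub> k \<otimes>\<^bsub>Q\<^esub> (x \<oplus>\<^bsub>Q\<^esub> y)"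
      using cd x y by (simp add: Q.m_assoc)
    then show ?case using step[OF Suc] by simp
  qed
  moreover have "z \<in> K" if "z \<in> D" for z
  proof -
    have "z \<otimes>\<^bsub>Q\<^esub> (x [^]\<^bsub>Q\<^esub> (0::nat) \<otimes>\<^bsub>Q\<^esub> y [^]\<^bsub>Q\<^esub> (0::nat)) \<in> K" "z \<in> carrier Q" using that unfolding D_def by blast+
    then show ?thesis by simp
  qed
  ultimately have "common_denominator (x \<oplus>\<^bsub>Q\<^esub> y) (c \<otimes> d)"
    unfolding common_denominator_def using cd by auto
  then show ?thesis
    using common_denominator_imp_integral[OF noeth, of "x \<oplus>\<^bsub>Q\<^esub> y" "c \<otimes> d"] nonzerodivisors_mult c d x y by auto
qed

text \<open>Write \<open>x = a/b\<close>. The common denominators of the powers of \<open>x\<close> form an ideal \<open>I0\<close> with \<open>x I0 \<subseteq> I0\<close>. It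
contains a nonzerodivisor, so it generates a nonzero ideal \<open>I\<close> of the local ring at \<open>P\<close>, which \<open>a/b\<close> maps
into itself. Since this local ring is normal, it contains \<open>a/b\<close>.\<close>

lemma regular_point_denominator:
  assumes P: "primeideal P R" and regular: "regular_local_ring (localization R (carrier R - P))"
    and x: "x \<in> carrier Q" "integral_over Q K x"
  shows "\<exists>u\<in>carrier R - P. j u \<otimes>\<^bsub>Q\<^esub> x \<in> K"
proof -
  define S where "S = carrier R - P"
  let ?L = "localization R S"
  interpret S: mult_set R S unfolding S_def by (rule mult_set_prime_complement[OF P])
  interpret L: cring ?L by (rule S.cring_localization)
  obtain a b where ab: "a \<in> carrier R" "b \<in> nonzerodivisors R" "j b \<otimes>\<^bsub>Q\<^esub> x = j a"
    using denominator[OF x(1)] by blast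
  have bc: "b \<in> carrier R" using nonzerodivisorsD ab by blast
  obtain c where c: "c \<in> nonzerodivisors R" "common_denominator x c"
    using integral_imp_common_denominator[OF x] by blast
  define I0 where "I0 = Collect (common_denominator x)"
  have I0c: "z \<in> carrier R" if "z \<in> I0" for z using that by (simp add: I0_def common_denominator_def)
  have I0_add: "z \<oplus> z' \<in> I0" if "z \<in> I0" "z' \<in> I0" for z z'
    using that subringE(7)[OF subring_K] x unfolding I0_def common_denominator_def
    by (auto simp: Q.l_distr simp del: image_iff)
  have I0_mult: "r \<otimes> z \<in> I0" if "r \<in> carrier R" "z \<in> I0" for r z
    using that subringE(6)[OF subring_K, of "j r"] x unfolding I0_def common_denominator_def
    by (auto simp: Q.m_assoc simp del: image_iff)
  have I0_x: "\<exists>d\<in>I0. a \<otimes> z = b \<otimes> d" if z: "z \<in> I0" for z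
  proof -
    have zc: "z \<in> carrier R" and zk: "\<And>k::nat. j z \<otimes>\<^bsub>Q\<^esub> x [^]\<^bsub>Q\<^esub> k \<in> K"
      using z unfolding I0_def common_denominator_def by auto
    obtain d where d: "d \<in> carrier R" "j z \<otimes>\<^bsub>Q\<^esub> x = j d" using zk[of 1] x by auto
    have "j d \<otimes>\<^bsub>Q\<^esub> x [^]\<^bsub>Q\<^esub> k \<in> K" for k :: nat
    proof -
      have "j d \<otimes>\<^bsub>Q\<^esub> x [^]\<^bsub>Q\<^esub> k = j z \<otimes>\<^bsub>Q\<^esub> x [^]\<^bsub>Q\<^esub> Suc k"
        unfolding d(2)[symmetric] using zc x by (simp add: Q.m_ac)
      then show ?thesis by (simp only: zk)
    qed
    then have "d \<in> I0" using d unfolding I0_def common_denominator_def by blast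
    moreover have "j (a \<otimes> z) = j (b \<otimes> d)"
      using ab bc zc d x by (simp flip: ab(3) d(2) add: Q.m_ac)
    then have "a \<otimes> z = b \<otimes> d" using j_eqD ab bc zc d by simp
    ultimately show ?thesis by blast
  qed
  define I where "I = {mk_frac R S z s | z s. z \<in> I0 \<and> s \<in> S}"
  have I: "ideal I ?L"
  proof (rule L.ideal_intro)
    show "I \<subseteq> carrier ?L" using I0c by (auto simp: I_def)
    have "\<zero> \<in> I0" using I0_mult[of \<zero> c] c nonzerodivisorsD by (simp add: I0_def)
    then show "\<zero>\<^bsub>?L\<^esub> \<in> I" unfolding I_def S.zero_localization using S.one_closed by blast
  next
    fix p q assume "p \<in> I" "q \<in> I"
    then obtain z s z' s' where h: "p = mk_frac R S z s" "z \<in> I0" "s \<in> S"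
      "q = mk_frac R S z' s'" "z' \<in> I0" "s' \<in> S" unfolding I_def by blast
    have "p \<oplus>\<^bsub>?L\<^esub> q = mk_frac R S (s' \<otimes> z \<oplus> s \<otimes> z') (s \<otimes> s')"
      using h I0c by (simp add: S.frac_add)
    moreover have "s' \<otimes> z \<oplus> s \<otimes> z' \<in> I0" using h I0_add I0_mult by simp
    ultimately show "p \<oplus>\<^bsub>?L\<^esub> q \<in> I" unfolding I_def using S.m_closed[OF h(3,6)] by blast
  next
    fix r p assume "r \<in> carrier ?L" "p \<in> I"
    then obtain z s e t where h: "p = mk_frac R S z s" "z \<in> I0" "s \<in> S"
      "r = mk_frac R S e t" "e \<in> carrier R" "t \<in> S"
      unfolding I_def by (auto elim!: S.localization_cases)
    have "r \<otimes>\<^bsub>?L\<^esub> p = mk_frac R S (e \<otimes> z) (t \<otimes> s)"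
      using h I0c by (simp add: S.frac_mult)
    then show "r \<otimes>\<^bsub>?L\<^esub> p \<in> I" unfolding I_def using S.m_closed[OF h(6,3)] I0_mult[OF h(5,2)] by blast
  qed
  have normal: "normal_modulo ?L {\<zero>\<^bsub>?L\<^esub>}" by (rule regular_local_ring_normal) (use regular in \<open>simp add: S_def\<close>)
  have zero_I: "{\<zero>\<^bsub>?L\<^esub>} \<subset> I"
  proof -
    have "loc_map R S c \<in> I" 
      unfolding I_def loc_map_def I0_def using c(2) S.one_closed by blast
    moreover have "loc_map R S c \<noteq> \<zero>\<^bsub>?L\<^esub>"
    proof
      assume "loc_map R S c = \<zero>\<^bsub>?L\<^esub>"
      then have "\<zero>\<^bsub>?L\<^esub> \<in> nonzerodivisors ?L" using S.loc_map_nonzerodivisor[OF c(1)] by simp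
      then have "\<one>\<^bsub>?L\<^esub> = \<zero>\<^bsub>?L\<^esub>"
        unfolding nonzerodivisors_def using L.l_null[OF L.one_closed] L.one_closed by blast
      then show False using normal primeideal_memD(2)[of "{\<zero>\<^bsub>?L\<^esub>}" ?L]
        unfolding normal_modulo_def by auto
    qed
    ultimately show ?thesis using ideal_memD(2)[OF I] by auto
  qed
  have mult: "multiplies_into ?L {\<zero>\<^bsub>?L\<^esub>} I (loc_map R S a) (loc_map R S b)"
    unfolding multiplies_into_def
  proof
    fix p assume "p \<in> I"
    then obtain z s where h: "p = mk_frac R S z s" "z \<in> I0" "s \<in> S" unfolding I_def by blast
    obtain d where d: "d \<in> I0" "a \<otimes> z = b \<otimes> d" using I0_x[OF h(2)] by blast
    have "loc_map R S a \<otimes>\<^bsub>?L\<^esub> p = loc_map R S b \<otimes>\<^bsub>?L\<^esub> mk_frac R S d s"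
      unfolding h(1) loc_map_def using h ab bc d I0c by (simp add: S.frac_mult)
    moreover have "loc_map R S b \<otimes>\<^bsub>?L\<^esub> mk_frac R S d s \<in> carrier ?L"
      using bc d h I0c ring_hom_closed[OF S.loc_map_hom] by simp
    ultimately have "loc_map R S a \<otimes>\<^bsub>?L\<^esub> p \<ominus>\<^bsub>?L\<^esub> loc_map R S b \<otimes>\<^bsub>?L\<^esub> mk_frac R S d s \<in> {\<zero>\<^bsub>?L\<^esub>}"
      by (simp add: L.r_neg a_minus_def)
    then show "\<exists>d\<in>I. loc_map R S a \<otimes>\<^bsub>?L\<^esub> p \<ominus>\<^bsub>?L\<^esub> loc_map R S b \<otimes>\<^bsub>?L\<^esub> d \<in> {\<zero>\<^bsub>?L\<^esub>}"
      unfolding I_def using d h by blast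
  qed
  have lc: "loc_map R S a \<in> carrier ?L" "loc_map R S b \<in> carrier ?L"
    using ab bc ring_hom_closed[OF S.loc_map_hom] by auto
  obtain r where r: "r \<in> carrier ?L"
    "loc_map R S a \<ominus>\<^bsub>?L\<^esub> loc_map R S b \<otimes>\<^bsub>?L\<^esub> r \<in> {\<zero>\<^bsub>?L\<^esub>}"
    using normal_moduloD[OF normal I zero_I lc mult] by blast
  then have eq: "loc_map R S a = loc_map R S b \<otimes>\<^bsub>?L\<^esub> r" using lc by simp
  obtain e s where es: "r = mk_frac R S e s" "e \<in> carrier R" "s \<in> S"
    using r(1) by (rule S.localization_cases)
  have "mk_frac R S a \<one> = mk_frac R S (b \<otimes> e) s"
    using eq es bc unfolding loc_map_def by (simp add: S.frac_mult)
  then obtain u where u: "u \<in> S" "u \<otimes> (s \<otimes> a) = u \<otimes> (b \<otimes> e)"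
    using es ab bc S.frac_eq_iff[of a \<one> "b \<otimes> e" s] by auto
  have uc: "u \<in> carrier R" "s \<in> carrier R" using u es by auto
  have "j b \<otimes>\<^bsub>Q\<^esub> (j (u \<otimes> s) \<otimes>\<^bsub>Q\<^esub> x) = j (u \<otimes> (s \<otimes> a))"
    using uc ab bc x(1) by (simp flip: ab(3) add: Q.m_ac)
  also have "\<dots> = j b \<otimes>\<^bsub>Q\<^esub> j (u \<otimes> e)" unfolding u(2) using uc bc es by (simp add: Q.m_ac)
  finally have "j (u \<otimes> s) \<otimes>\<^bsub>Q\<^esub> x = j (u \<otimes> e)"
    using Q.Units_l_cancel[OF j_Units[OF ab(2)]] uc es x(1) by simp
  moreover have "u \<otimes> e \<in> carrier R" using uc es by simp
  ultimately have "j (u \<otimes> s) \<otimes>\<^bsub>Q\<^esub> x \<in> K" by blast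
  then show ?thesis using S.m_closed[OF u(1) es(3)] unfolding S_def by blast
qed

end

lemma to_fractions_mult_frac:
  fixes R (structure)
  assumes "cring R" and a: "a \<in> carrier R" and b: "b \<in> nonzerodivisors R"
  shows "to_fractions R b \<otimes>\<^bsub>total_fractions R\<^esub> mk_frac R (nonzerodivisors R) a b = to_fractions R a"
proof -
  interpret cring R by fact
  interpret N: mult_set R "nonzerodivisors R" by (rule mult_set_nonzerodivisors) fact
  have bc: "b \<in> carrier R" using b by simp
  have "mk_frac R (nonzerodivisors R) (b \<otimes> a) (\<one> \<otimes> b) = mk_frac R (nonzerodivisors R) a \<one>"
    using a b bc by (intro N.frac_eqI) simp_all
  then show ?thesis
    using N.frac_mult[OF bc N.one_closed a b] by (simp add: to_fractions_def total_fractions_def loc_map_def)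
qed

lemma fraction_ring_total_fractions:
  assumes "cring R"
  shows "fraction_ring R (total_fractions R) (to_fractions R)"
proof -
  interpret cring R by fact
  interpret N: mult_set R "nonzerodivisors R" by (rule mult_set_nonzerodivisors) fact
  interpret Q: cring "total_fractions R" unfolding total_fractions_def by (rule N.cring_localization)
  show ?thesis
  proof (intro fraction_ring.intro fraction_ring_axioms.intro)
    show "to_fractions R \<in> ring_hom R (total_fractions R)"
      using N.loc_map_hom by (simp add: to_fractions_def total_fractions_def)
    show "inj_on (to_fractions R) (carrier R)"
    proof (rule inj_onI)
      fix a b assume h: "a \<in> carrier R" "b \<in> carrier R" "to_fractions R a = to_fractions R b"
      then obtain u where u: "u \<in> nonzerodivisors R" "u \<otimes>\<^bsub>R\<^esub> a = u \<otimes>\<^bsub>R\<^esub> b"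
        by (auto simp: to_fractions_def loc_map_def N.frac_eq_iff)
      have uc: "u \<in> carrier R" using u by simp
      have "u \<otimes>\<^bsub>R\<^esub> (a \<ominus>\<^bsub>R\<^esub> b) = u \<otimes>\<^bsub>R\<^esub> a \<ominus>\<^bsub>R\<^esub> u \<otimes>\<^bsub>R\<^esub> b" using h uc by algebra
      also have "\<dots> = \<zero>\<^bsub>R\<^esub>" unfolding u(2) using h uc by simp
      finally have "a \<ominus>\<^bsub>R\<^esub> b = \<zero>\<^bsub>R\<^esub>" using u(1) h unfolding nonzerodivisors_def by blast
      then show "a = b" using h by simp
    qed
    show "to_fractions R b \<in> Units (total_fractions R)" if "b \<in> nonzerodivisors R" for b
      using N.loc_map_Units(1)[OF that] by (simp add: to_fractions_def total_fractions_def)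
    show "\<exists>a\<in>carrier R. \<exists>b\<in>nonzerodivisors R. to_fractions R b \<otimes>\<^bsub>total_fractions R\<^esub> x = to_fractions R a"
      if x: "x \<in> carrier (total_fractions R)" for x
    proof -
      obtain a b where ab: "x = mk_frac R (nonzerodivisors R) a b" "a \<in> carrier R" "b \<in> nonzerodivisors R"
        using x unfolding total_fractions_def by (rule N.localization_cases)
      then have "to_fractions R b \<otimes>\<^bsub>total_fractions R\<^esub> x = to_fractions R a"
        using to_fractions_mult_frac[OF assms] by simp
      then show ?thesis using ab by blast
    qed
  qed (rule assms, rule Q.is_cring)
qed

section \<open>Comparison with the localized normalization\<close>

text \<open>The canonical map from the total ring of fractions of \<open>R\<close> to that of the localization; being a ring
homomorphism, it carries integral elements to integral elements.\<close>

lemma (in mult_set) fractions_map_hom: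
  shows "fractions_map R S \<in> ring_hom (total_fractions R) (total_fractions (localization R S))"
    and "a \<in> carrier R \<Longrightarrow> b \<in> nonzerodivisors R \<Longrightarrow>
      fractions_map R S (mk_frac R (nonzerodivisors R) a b)
      = mk_frac (localization R S) (nonzerodivisors (localization R S)) (loc_map R S a) (loc_map R S b)"
proof -
  let ?L = "localization R S" and ?N = "nonzerodivisors R"
  let ?Q = "total_fractions ?L" and ?f = "\<lambda>a. to_fractions ?L (loc_map R S a)"
  interpret L: cring ?L by (rule cring_localization)
  interpret N: mult_set R ?N by (rule mult_set_nonzerodivisors) (rule is_cring)
  interpret NL: mult_set ?L "nonzerodivisors ?L" by (rule mult_set_nonzerodivisors) (rule L.is_cring)
  interpret Q: cring ?Q unfolding total_fractions_def by (rule NL.cring_localization)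
  have f: "?f \<in> ring_hom R ?Q"
    using ring_hom_trans[OF loc_map_hom NL.loc_map_hom]
    by (simp add: to_fractions_def total_fractions_def comp_def)
  have U: "?f x \<in> Units ?Q" and inv_f: "inv\<^bsub>?Q\<^esub> (?f x)
      = mk_frac ?L (nonzerodivisors ?L) \<one>\<^bsub>?L\<^esub> (loc_map R S x)" if "x \<in> ?N" for x
    using NL.loc_map_Units[OF loc_map_nonzerodivisor[OF that]]
    by (auto simp: to_fractions_def total_fractions_def)
  have UN: "?f ` ?N \<subseteq> Units ?Q" using U by auto
  show "fractions_map R S \<in> ring_hom (total_fractions R) ?Q"
    unfolding fractions_map_def using N.loc_lift_hom[OF Q.is_cring f UN]
    by (simp add: total_fractions_def)
  assume ab: "a \<in> carrier R" "b \<in> ?N"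
  have "fractions_map R S (mk_frac R ?N a b) = ?f a \<otimes>\<^bsub>?Q\<^esub> inv\<^bsub>?Q\<^esub> (?f b)"
    unfolding fractions_map_def using N.loc_lift_frac[OF Q.is_cring f UN ab] .
  then show "fractions_map R S (mk_frac R ?N a b)
      = mk_frac ?L (nonzerodivisors ?L) (loc_map R S a) (loc_map R S b)"
    using ab ring_hom_closed[OF loc_map_hom] loc_map_nonzerodivisor[OF ab(2)]
    by (simp add: inv_f)
      (simp add: to_fractions_def total_fractions_def loc_map_def[of ?L] NL.frac_mult)
qed

text \<open>The image of \<open>x\<close> in the total ring of fractions of the localization \<open>L\<close> is integral over \<open>L\<close>, so by
hypothesis it equals the image of some \<open>y/s\<close> with \<open>y \<in> B\<close>. With \<open>x = a/b\<close> and \<open>y = c/d\<close>, equality of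
the images means that \<open>d s a\<close> and \<open>b c\<close> agree in \<open>L\<close>, as nonzerodivisors of \<open>L\<close> cancel. So
\<open>t d s a = t b c\<close> in \<open>R\<close> for some \<open>t \<in> S\<close>, that is, \<open>(t s) x = t y\<close>.\<close>

lemma (in mult_set) denominator_of_local_equality:
  assumes B: "subring B (total_fractions R)" "to_fractions R ` carrier R \<subseteq> B"
    and eq: "loc_total_map R S ` loc_intermediate R S B = normalization (localization R S)"
    and x: "x \<in> normalization R"
  shows "\<exists>u\<in>S. to_fractions R u \<otimes>\<^bsub>total_fractions R\<^esub> x \<in> B"
proof -
  let ?L = "localization R S" and ?N = "nonzerodivisors R" and ?Q = "total_fractions R"
  let ?NL = "nonzerodivisors ?L" and ?j = "to_fractions R"
  interpret L: cring ?L by (rule cring_localization)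
  interpret N: mult_set R ?N by (rule mult_set_nonzerodivisors) (rule is_cring)
  interpret NL: mult_set ?L ?NL by (rule mult_set_nonzerodivisors) (rule L.is_cring)
  interpret F: fraction_ring R ?Q ?j by (rule fraction_ring_total_fractions) (rule is_cring)
  interpret FL: fraction_ring ?L "total_fractions ?L" "to_fractions ?L"
    by (rule fraction_ring_total_fractions) (rule L.is_cring)
  note map = fractions_map_hom
  note frac = to_fractions_mult_frac[OF is_cring]
  have xQ: "x \<in> carrier ?Q" and int: "integral_over ?Q (?j ` carrier R) x"
    using x by (auto simp: normalization_def integral_closure_def)
  from xQ obtain a b where ab: "x = mk_frac R ?N a b" "a \<in> carrier R" "b \<in> ?N"
    unfolding total_fractions_def by (rule N.localization_cases)
  have "fractions_map R S ` (?j ` carrier R) \<subseteq> to_fractions ?L ` carrier ?L"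
  proof clarify
    fix r assume r: "r \<in> carrier R"
    have "\<one> \<in> ?N" by (rule N.one_closed)
    then have "fractions_map R S (?j r) = mk_frac ?L ?NL (loc_map R S r) (loc_map R S \<one>)"
      using map(2)[OF r] by (simp add: to_fractions_def loc_map_def)
    also have "\<dots> = to_fractions ?L (loc_map R S r)"
      using ring_hom_one[OF loc_map_hom] by (simp add: to_fractions_def loc_map_def[of ?L])
    finally show "fractions_map R S (?j r) \<in> to_fractions ?L ` carrier ?L"
      using ring_hom_closed[OF loc_map_hom r] by blast
  qed
  then have "integral_over (total_fractions ?L) (to_fractions ?L ` carrier ?L) (fractions_map R S x)"
    by (rule integral_over_hom[OF F.Q.ring_axioms FL.Q.ring_axioms map(1) subringE(1)[OF F.subring_K] _ xQ int])
  then have "fractions_map R S x \<in> normalization ?L"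
    unfolding normalization_def integral_closure_def using ring_hom_closed[OF map(1) xQ] by simp
  then obtain y s where ys: "y \<in> B" "s \<in> S"
    "fractions_map R S x = loc_total_map R S (mk_frac ?Q (?j ` S) y (?j s))"
    unfolding eq[symmetric] loc_intermediate_def loc_subset_def by blast
  have "y \<in> carrier ?Q" using ys subringE(1)[OF B(1)] by blast
  then obtain c d where cd: "y = mk_frac R ?N c d" "c \<in> carrier R" "d \<in> ?N"
    unfolding total_fractions_def by (rule N.localization_cases)
  have carr: "b \<in> carrier R" "d \<in> carrier R" "s \<in> carrier R" using ab cd ys by auto
  have nzd_s: "loc_map R S (d \<otimes> s) \<in> ?NL"
  proof -
    have "loc_map R S s \<in> ?NL"
    proof -
      have U: "loc_map R S s \<in> Units ?L" by (rule loc_map_Units(1)[OF ys(2)])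
      have "z = \<zero>\<^bsub>?L\<^esub>" if "z \<in> carrier ?L" "loc_map R S s \<otimes>\<^bsub>?L\<^esub> z = \<zero>\<^bsub>?L\<^esub>" for z
        using U that L.Units_l_cancel[of "loc_map R S s" z "\<zero>\<^bsub>?L\<^esub>"] L.Units_closed[OF U] by simp
      then show ?thesis using L.Units_closed[OF U] unfolding nonzerodivisors_def by blast
    qed
    then show ?thesis
      using NL.m_closed[OF loc_map_nonzerodivisor[OF cd(3)]] ring_hom_mult[OF loc_map_hom carr(2,3)] by simp
  qed
  have "mk_frac ?L ?NL (loc_map R S a) (loc_map R S b) = mk_frac ?L ?NL (loc_map R S c) (loc_map R S (d \<otimes> s))"
    using ys(3) map(2)[OF ab(2,3)] loc_total_map_frac[OF cd(2,3) ys(2)] unfolding ab(1) cd(1) by simp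
  then obtain u where u: "u \<in> ?NL" "u \<otimes>\<^bsub>?L\<^esub> (loc_map R S (d \<otimes> s) \<otimes>\<^bsub>?L\<^esub> loc_map R S a)
      = u \<otimes>\<^bsub>?L\<^esub> (loc_map R S b \<otimes>\<^bsub>?L\<^esub> loc_map R S c)"
    using NL.frac_eq_iff[OF ring_hom_closed[OF loc_map_hom ab(2)] loc_map_nonzerodivisor[OF ab(3)]
        ring_hom_closed[OF loc_map_hom cd(2)] nzd_s] by blast
  have "u \<otimes>\<^bsub>?L\<^esub> loc_map R S (d \<otimes> s \<otimes> a) = u \<otimes>\<^bsub>?L\<^esub> loc_map R S (b \<otimes> c)"
    using u(2) ring_hom_mult[OF loc_map_hom] carr ab(2) cd(2) by simp
  moreover have uc: "u \<in> carrier ?L" using u(1) by (rule NL.S_carr)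
  moreover have lc: "loc_map R S (d \<otimes> s \<otimes> a) \<in> carrier ?L" "loc_map R S (b \<otimes> c) \<in> carrier ?L"
    using ring_hom_closed[OF loc_map_hom] carr ab(2) cd(2) by auto
  ultimately have "u \<otimes>\<^bsub>?L\<^esub> (loc_map R S (d \<otimes> s \<otimes> a) \<ominus>\<^bsub>?L\<^esub> loc_map R S (b \<otimes> c)) = \<zero>\<^bsub>?L\<^esub>"
    by (simp add: a_minus_def L.r_distr L.r_minus L.r_neg)
  then have "loc_map R S (d \<otimes> s \<otimes> a) \<ominus>\<^bsub>?L\<^esub> loc_map R S (b \<otimes> c) = \<zero>\<^bsub>?L\<^esub>"
    using u(1) lc L.minus_closed unfolding nonzerodivisors_def by blast
  then have "loc_map R S (d \<otimes> s \<otimes> a) = loc_map R S (b \<otimes> c)" using lc by simp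
  then obtain t where t: "t \<in> S" "t \<otimes> (d \<otimes> s \<otimes> a) = t \<otimes> (b \<otimes> c)"
    using carr ab(2) cd(2) unfolding loc_map_def by (auto simp: frac_eq_iff)
  have tc: "t \<in> carrier R" using t by simp
  have yQ: "y \<in> carrier ?Q" by fact
  note jx = frac[OF ab(2,3), folded ab(1)] and jy = frac[OF cd(2,3), folded cd(1)]
  have "?j (b \<otimes> d) \<otimes>\<^bsub>?Q\<^esub> (?j (t \<otimes> s) \<otimes>\<^bsub>?Q\<^esub> x) = ?j (t \<otimes> (d \<otimes> s)) \<otimes>\<^bsub>?Q\<^esub> (?j b \<otimes>\<^bsub>?Q\<^esub> x)"
    using carr tc xQ by (simp add: F.Q.m_ac)
  also have "\<dots> = ?j (t \<otimes> (d \<otimes> s \<otimes> a))" unfolding jx using carr tc ab(2) by (simp add: F.Q.m_assoc)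
  also have "\<dots> = ?j (t \<otimes> b) \<otimes>\<^bsub>?Q\<^esub> ?j c" unfolding t(2) using carr tc cd(2) by (simp add: F.Q.m_assoc)
  also have "\<dots> = ?j (b \<otimes> d) \<otimes>\<^bsub>?Q\<^esub> (?j t \<otimes>\<^bsub>?Q\<^esub> y)"
    unfolding jy[symmetric] using carr tc yQ by (simp add: F.Q.m_ac)
  finally have "?j (t \<otimes> s) \<otimes>\<^bsub>?Q\<^esub> x = ?j t \<otimes>\<^bsub>?Q\<^esub> y"
    using F.Q.Units_l_cancel[OF F.j_Units[OF F.nonzerodivisors_mult[OF ab(3) cd(3)]]] carr tc xQ yQ by simp
  moreover have "?j t \<otimes>\<^bsub>?Q\<^esub> y \<in> B" using subringE(6)[OF B(1)] B(2) tc ys(1) by blast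
  ultimately show ?thesis using m_closed[OF t(1) ys(2)] by (intro bexI[of _ "t \<otimes> s"]) simp_all
qed

lemma (in cring) finsum_closed_subset:
  assumes "finite I" "C \<subseteq> carrier R" "\<zero> \<in> C" "\<And>x y. x \<in> C \<Longrightarrow> y \<in> C \<Longrightarrow> x \<oplus> y \<in> C"
    and "\<And>i. i \<in> I \<Longrightarrow> b i \<in> C"
  shows "(\<Oplus>i\<in>I. b i) \<in> C"
  using assms(1,5)
proof (induction I)
  case (insert i I)
  then have "(\<Oplus>k\<in>insert i I. b k) = b i \<oplus> (\<Oplus>k\<in>I. b k)"
    using assms(2) by (intro finsum_insert) auto
  then show ?case using insert assms(4) by simp
qed (use assms(3) in simp)

theorem proposition3p2:
  fixes A :: "('a, 'm) ring_scheme"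
    and s :: nat
    and V :: "nat \<Rightarrow> 'a set set"
    and B :: "nat \<Rightarrow> ('a \<times> 'a) set set"
  assumes "cring A" and "noetherian_ring A" and "reduced_ring A"
    and "s \<ge> 1"
    and "Strata A = V ` {1..s}"
    and "\<And>i. i \<in> {1..s} \<Longrightarrow> subring (B i) (total_fractions A)"
    and "\<And>i. i \<in> {1..s} \<Longrightarrow> to_fractions A ` carrier A \<subseteq> B i"
    and "\<And>i. i \<in> {1..s} \<Longrightarrow> B i \<subseteq> normalization A"
    and "\<And>i P S. i \<in> {1..s} \<Longrightarrow> P \<in> V i \<Longrightarrow> S = carrier A - P \<Longrightarrow>
           loc_total_map A S ` loc_intermediate A S (B i) = normalization (localization A S)"
  shows "{(\<Oplus>\<^bsub>total_fractions A\<^esub>i\<in>{1..s}. b i) | b. \<forall>i\<in>{1..s}. b i \<in> B i} = normalization A"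
proof
  let ?Q = "total_fractions A" and ?j = "to_fractions A"
  let ?sum = "{(\<Oplus>\<^bsub>?Q\<^esub>i\<in>{1..s}. b i) | b. \<forall>i\<in>{1..s}. b i \<in> B i}"
  interpret A: cring A by fact
  interpret noetherian_cring A using assms(1,2) by (simp add: noetherian_cring_def)
  interpret F: fraction_ring A ?Q ?j by (rule fraction_ring_total_fractions) fact
  note subr = assms(6) and in_B = assms(7)
  have B_carr: "B i \<subseteq> carrier ?Q" if "i \<in> {1..s}" for i using subringE(1)[OF subr[OF that]] .
  have norm: "normalization A = {x \<in> carrier ?Q. integral_over ?Q (?j ` carrier A) x}"
    by (simp add: normalization_def integral_closure_def)
  show "?sum \<subseteq> normalization A"
  proof clarify
    fix b assume b: "\<forall>i\<in>{1..s}. b i \<in> B i"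
    show "(\<Oplus>\<^bsub>?Q\<^esub>i\<in>{1..s}. b i) \<in> normalization A"
    proof (rule F.Q.finsum_closed_subset)
      show "normalization A \<subseteq> carrier ?Q" unfolding norm by blast
      have "\<zero>\<^bsub>?Q\<^esub> \<in> B 1" using subringE(2)[OF subr[of 1]] assms(4) by simp
      then show "\<zero>\<^bsub>?Q\<^esub> \<in> normalization A" using assms(4,8) by (meson atLeastAtMost_iff order_refl subsetD)
      show "x \<oplus>\<^bsub>?Q\<^esub> y \<in> normalization A" if "x \<in> normalization A" "y \<in> normalization A" for x y
        using that F.integral_add[OF assms(2)] unfolding norm by simp
      show "b i \<in> normalization A" if "i \<in> {1..s}" for i using b assms(8) that by blast
    qed simp
  qed
  have sum_add: "p \<oplus>\<^bsub>?Q\<^esub> q \<in> ?sum" if pq: "p \<in> ?sum" "q \<in> ?sum" for p q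
  proof -
    obtain b c where bc: "p = (\<Oplus>\<^bsub>?Q\<^esub>i\<in>{1..s}. b i)" "\<forall>i\<in>{1..s}. b i \<in> B i"
      "q = (\<Oplus>\<^bsub>?Q\<^esub>i\<in>{1..s}. c i)" "\<forall>i\<in>{1..s}. c i \<in> B i" using pq by blast
    have "p \<oplus>\<^bsub>?Q\<^esub> q = (\<Oplus>\<^bsub>?Q\<^esub>i\<in>{1..s}. b i \<oplus>\<^bsub>?Q\<^esub> c i)"
      unfolding bc(1,3) by (rule F.Q.finsum_addf[symmetric]) (use bc(2,4) B_carr in \<open>blast intro: Pi_I\<close>)+
    moreover have "\<forall>i\<in>{1..s}. b i \<oplus>\<^bsub>?Q\<^esub> c i \<in> B i" using bc(2,4) subringE(7)[OF subr] by blast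
    ultimately show ?thesis by blast
  qed
  have sum_mult: "?j r \<otimes>\<^bsub>?Q\<^esub> p \<in> ?sum" if r: "r \<in> carrier A" and p: "p \<in> ?sum" for r p
  proof -
    obtain b where b: "p = (\<Oplus>\<^bsub>?Q\<^esub>i\<in>{1..s}. b i)" "\<forall>i\<in>{1..s}. b i \<in> B i" using p by blast
    have "?j r \<otimes>\<^bsub>?Q\<^esub> p = (\<Oplus>\<^bsub>?Q\<^esub>i\<in>{1..s}. ?j r \<otimes>\<^bsub>?Q\<^esub> b i)"
      unfolding b(1) by (rule F.Q.finsum_rdistr) (use b(2) B_carr r in \<open>simp, simp, blast intro: Pi_I\<close>)
    moreover have "\<forall>i\<in>{1..s}. ?j r \<otimes>\<^bsub>?Q\<^esub> b i \<in> B i" using b(2) subringE(6)[OF subr] in_B r by blast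
    ultimately show ?thesis by blast
  qed
  have B_sum: "p \<in> ?sum" if i: "i \<in> {1..s}" and p: "p \<in> B i" for i p
  proof -
    define b where "b k = (if i = k then p else \<zero>\<^bsub>?Q\<^esub>)" for k
    have pc: "p \<in> carrier ?Q" using B_carr i p by blast
    have "(\<Oplus>\<^bsub>?Q\<^esub>k\<in>{1..s}. b k) = p"
      using F.Q.finsum_singleton[OF i, of "\<lambda>_. p"] pc unfolding b_def by simp
    moreover have "\<forall>k\<in>{1..s}. b k \<in> B k"
      using p subringE(2)[OF subr] unfolding b_def by (simp del: One_nat_def)
    ultimately show ?thesis by blast
  qed
  show "normalization A \<subseteq> ?sum"
  proof
    fix x assume x: "x \<in> normalization A"
    then have xQ: "x \<in> carrier ?Q" and int: "integral_over ?Q (?j ` carrier A) x" unfolding norm by auto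
    \<comment> \<open>it suffices that this ideal is not proper\<close>
    define I where "I = {a \<in> carrier A. ?j a \<otimes>\<^bsub>?Q\<^esub> x \<in> ?sum}"
    have "ideal I A"
    proof (rule A.ideal_intro)
      show "I \<subseteq> carrier A" unfolding I_def by blast
      have "\<zero>\<^bsub>?Q\<^esub> \<in> ?sum" using B_sum[of 1] subringE(2)[OF subr[of 1]] assms(4) by simp
      then show "\<zero>\<^bsub>A\<^esub> \<in> I" unfolding I_def using xQ by simp
      show "a \<oplus>\<^bsub>A\<^esub> b \<in> I" if "a \<in> I" "b \<in> I" for a b
        using that sum_add xQ unfolding I_def by (simp add: F.Q.l_distr)
      show "r \<otimes>\<^bsub>A\<^esub> a \<in> I" if "r \<in> carrier A" "a \<in> I" for r a
        using that sum_mult xQ unfolding I_def by (simp add: F.Q.m_assoc)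
    qed
    have "I = carrier A"
    proof (rule ccontr)
      assume "I \<noteq> carrier A"
      then obtain z where z: "z \<in> carrier A" "primeideal (colon A I z) A"
        using exists_associated_prime[OF \<open>ideal I A\<close>] by blast
      define P where "P = colon A I z"
      have P: "primeideal P A" and IP: "I \<subseteq> P"
        unfolding P_def using z A.ideal_colon(2)[OF \<open>ideal I A\<close>] by auto
      have "\<exists>u\<in>carrier A - P. ?j u \<otimes>\<^bsub>?Q\<^esub> x \<in> ?sum"
      proof (cases "P \<in> Sing A")
        case True
        then have "stratum A (stratum_ideal A P) \<in> V ` {1..s}"
          unfolding assms(5)[symmetric] Strata_def by blast
        then obtain i where i: "i \<in> {1..s}" "stratum A (stratum_ideal A P) = V i" by blast
        have "P \<in> V i" unfolding i(2)[symmetric] stratum_def using True by simp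
        then have "loc_total_map A (carrier A - P) ` loc_intermediate A (carrier A - P) (B i)
            = normalization (localization A (carrier A - P))"
          using assms(9)[OF i(1)] by blast
        then have "\<exists>u\<in>carrier A - P. ?j u \<otimes>\<^bsub>?Q\<^esub> x \<in> B i"
          using mult_set.denominator_of_local_equality[OF mult_set_prime_complement[OF P] subr[OF i(1)] in_B[OF i(1)] _ x]
          by blast
        then show ?thesis using B_sum[OF i(1)] by blast
      next
        case False
        then have "regular_local_ring (localization A (carrier A - P))" using P by (simp add: Sing_def)
        then have "\<exists>u\<in>carrier A - P. ?j u \<otimes>\<^bsub>?Q\<^esub> x \<in> ?j ` carrier A"
          using F.regular_point_denominator[OF P _ xQ int] by blast
        then show ?thesis using B_sum[of 1] in_B[of 1] assms(4) by (meson atLeastAtMost_iff order_refl subsetD)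
      qed
      then show False using IP unfolding I_def by blast
    qed
    then have "\<one>\<^bsub>A\<^esub> \<in> I" by simp
    then show "x \<in> ?sum" unfolding I_def using xQ by simp
  qed
qed

end
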